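(* Let $k\ge 0$ and let $X=\{a_0,\dots,a_k\}$ be a set with $k+1$ elements. Let $\mathcal L(X)=\bigcup_{i=0}^{k}\mathcal I(\mathcal B_k)_{[s_i,t_i]}$, with the operations inherited from $\mathcal I(\mathcal B_k)$, and let $\mathcal{F}r(X)$ be the free cubic implication algebra with generating set $X$. Then $\mathcal L(X)\simeq \mathcal{F}r(X)$ (isomorphism of cubic implication algebras).
   Context: A cubic implication algebra is a join semilattice with greatest element $\mathbf 1$ and a binary operation $\Delta$ such that: (a) if $x\le y$ then $\Delta(y,x)\vee x=y$; (b) if $x\le y\le z$ then $\Delta(z,\Delta(y,x))=\Delta(\Delta(z,y),\Delta(z,x))$; (c) if $x\le y$ then $\Delta(y,\Delta(y,x))=x$; (d) if $x\le y\le z$ then $\Delta(z,x)\le\Delta(z,y)$; and, writing $xy=\Delta(\mathbf 1,\Delta(x\vee y,y))\vee y$ for all $x,y$: (e) $(xy)y=x\vee y$; (f) $x(yz)=y(xz)$. The operation $\Delta(x,y)$ is used only for $y\le x$; as a total operation, $\Delta(x,y)$ is understood to mean $\Delta(x\vee y,y)$. Homomorphisms preserve $\mathbf 1$, $\vee$, $\Delta$; "free" is meant in this class of algebras. For a Boolean algebra $B$ (complement $\overline{b}$), the interval algebra is $\mathcal I(B)=\{[a,b]: a\le b \text{ in } B\}$ ordered by inclusion ($[c,d]\le[a,b]$ iff $a\le c$ and $d\le b$), with $\mathbf 1=[0,1]$, $[a,b]\vee[c,d]=[a\wedge c,b\vee d]$, and, for $[c,d]\le[a,b]$, $\Delta([a,b],[c,d])=[a\vee(b\wedge\overline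 d),\,b\wedge(a\vee\overline c)]$. It is a cubic implication algebra. For a cubic implication algebra $\mathcal L$ and $a\in\mathcal L$, the localization is $\mathcal L_a=\{\Delta(y,x): a\le x\le y\}$. For $k\ge 0$, $\mathcal B_k$ is the Boolean algebra generated by $s_0,\dots,s_k,t_0,\dots,t_k$ subject to the relations (i.e. the corresponding quotient of the free Boolean algebra on these $2k+2$ generators): $s_0=0$; $s_i\le t_i$ for $0\le i\le k$; $t_0\le\bigvee_{j=1}^{i}s_j\vee t_{i+1}$ for $0\le i<k$; $t_0\le\bigvee_{j=1}^{k}s_j$. Empty joins are $0$. *)

theory Defs
  imports "HOL-Algebra.Congruence"
begin

section \<open>Cubic implication algebras\<close>

record 'a cubic = "'a partial_object" +
  cone :: 'a  (\<open>\<one>\<index>\<close>)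
  cjoin :: "'a \<Rightarrow> 'a \<Rightarrow> 'a"  (infixl \<open>\<squnion>\<index>\<close> 65)
  delta :: "'a \<Rightarrow> 'a \<Rightarrow> 'a"  (\<open>\<Delta>\<index>\<close>)

definition cle :: "('a, 'm) cubic_scheme \<Rightarrow> 'a \<Rightarrow> 'a \<Rightarrow> bool"  (infix \<open>\<sqsubseteq>\<index>\<close> 50)
  where "x \<sqsubseteq>\<^bsub>L\<^esub> y \<longleftrightarrow> x \<squnion>\<^bsub>L\<^esub> y = y"

definition cprod :: "('a, 'm) cubic_scheme \<Rightarrow> 'a \<Rightarrow> 'a \<Rightarrow> 'a"  (infixl \<open>\<odot>\<index>\<close> 70)
  where "x \<odot>\<^bsub>L\<^esub> y = \<Delta>\<^bsub>L\<^esub> \<one>\<^bsub>L\<^esub> (\<Delta>\<^bsub>L\<^esub> (x \<squnion>\<^bsub>L\<^esub> y) y) \<squnion>\<^bsub>L\<^esub> y"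

text \<open>
  The operation \<open>\<Delta>\<close> is total; its values \<open>\<Delta> x y\<close> with \<open>y\<close> not below \<open>x\<close> are fixed by
  \<open>delta_total\<close>.  The derived operation \<open>x \<odot> y\<close> is the product usually
  written \<open>xy\<close>.
\<close>

locale cubic_implication_algebra =
  fixes L :: "('a, 'm) cubic_scheme" (structure)
  assumes one_closed: "\<one> \<in> carrier L"
    and join_closed: "\<lbrakk>x \<in> carrier L; y \<in> carrier L\<rbrakk> \<Longrightarrow> x \<squnion> y \<in> carrier L"
    and delta_closed: "\<lbrakk>x \<in> carrier L; y \<in> carrier L\<rbrakk> \<Longrightarrow> \<Delta> x y \<in> carrier L"
    and join_assoc: "\<lbrakk>x \<in> carrier L; y \<in> carrier L; z \<in> carrier L\<rbrakk>
      \<Longrightarrow> (x \<squnion> y) \<squnion> z = x \<squnion> (y \<squnion> z)"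
    and join_comm: "\<lbrakk>x \<in> carrier L; y \<in> carrier L\<rbrakk> \<Longrightarrow> x \<squnion> y = y \<squnion> x"
    and join_idem: "x \<in> carrier L \<Longrightarrow> x \<squnion> x = x"
    and one_greatest: "x \<in> carrier L \<Longrightarrow> x \<sqsubseteq> \<one>"
    and delta_total: "\<lbrakk>x \<in> carrier L; y \<in> carrier L\<rbrakk> \<Longrightarrow> \<Delta> x y = \<Delta> (x \<squnion> y) y"
    and delta_join: "\<lbrakk>x \<in> carrier L; y \<in> carrier L; x \<sqsubseteq> y\<rbrakk> \<Longrightarrow> \<Delta> y x \<squnion> x = y"
    and delta_delta: "\<lbrakk>x \<in> carrier L; y \<in> carrier L; z \<in> carrier L; x \<sqsubseteq> y; y \<sqsubseteq> z\<rbrakk>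
      \<Longrightarrow> \<Delta> z (\<Delta> y x) = \<Delta> (\<Delta> z y) (\<Delta> z x)"
    and delta_involution: "\<lbrakk>x \<in> carrier L; y \<in> carrier L; x \<sqsubseteq> y\<rbrakk> \<Longrightarrow> \<Delta> y (\<Delta> y x) = x"
    and delta_mono: "\<lbrakk>x \<in> carrier L; y \<in> carrier L; z \<in> carrier L; x \<sqsubseteq> y; y \<sqsubseteq> z\<rbrakk>
      \<Longrightarrow> \<Delta> z x \<sqsubseteq> \<Delta> z y"
    and prod_prod: "\<lbrakk>x \<in> carrier L; y \<in> carrier L\<rbrakk> \<Longrightarrow> (x \<odot> y) \<odot> y = x \<squnion> y"
    and prod_exchange: "\<lbrakk>x \<in> carrier L; y \<in> carrier L; z \<in> carrier L\<rbrakk>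
      \<Longrightarrow> x \<odot> (y \<odot> z) = y \<odot> (x \<odot> z)"

definition cubic_hom :: "('a, 'm) cubic_scheme \<Rightarrow> ('b, 'n) cubic_scheme \<Rightarrow> ('a \<Rightarrow> 'b) set"
  where "cubic_hom L M =
    {h. h \<in> carrier L \<rightarrow> carrier M \<and> h \<one>\<^bsub>L\<^esub> = \<one>\<^bsub>M\<^esub> \<and>
        (\<forall>x\<in>carrier L. \<forall>y\<in>carrier L. h (x \<squnion>\<^bsub>L\<^esub> y) = h x \<squnion>\<^bsub>M\<^esub> h y) \<and>
        (\<forall>x\<in>carrier L. \<forall>y\<in>carrier L. h (\<Delta>\<^bsub>L\<^esub> x y) = \<Delta>\<^bsub>M\<^esub> (h x) (h y))}"

definition cubic_iso :: "('a, 'm) cubic_scheme \<Rightarrow> ('b, 'n) cubic_scheme \<Rightarrow> bool"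
  (infix \<open>\<simeq>\<^sub>c\<close> 50)
  where "L \<simeq>\<^sub>c M \<longleftrightarrow> cubic_implication_algebra L \<and> cubic_implication_algebra M \<and>
    (\<exists>h\<in>cubic_hom L M. bij_betw h (carrier L) (carrier M))"

definition localization :: "('a, 'm) cubic_scheme \<Rightarrow> 'a \<Rightarrow> 'a set"
  where "localization L a =
    {\<Delta>\<^bsub>L\<^esub> y x | x y. x \<in> carrier L \<and> y \<in> carrier L \<and> a \<sqsubseteq>\<^bsub>L\<^esub> x \<and> x \<sqsubseteq>\<^bsub>L\<^esub> y}"


section \<open>Free cubic implication algebras\<close>

datatype (cgens: 'x) cubic_term =
    CGen 'x
  | COne
  | CJoin "'x cubic_term" "'x cubic_term"
  | CDelta "'x cubic_term" "'x cubic_term"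

definition cubic_terms :: "'x set \<Rightarrow> 'x cubic_term cubic"
  where "cubic_terms X =
    \<lparr>carrier = {p. cgens p \<subseteq> X}, cone = COne, cjoin = CJoin, delta = CDelta\<rparr>"

definition cubic_congruence :: "('a, 'm) cubic_scheme \<Rightarrow> ('a \<times> 'a) set \<Rightarrow> bool"
  where "cubic_congruence L \<theta> \<longleftrightarrow> equiv (carrier L) \<theta> \<and>
    (\<forall>(x, x') \<in> \<theta>. \<forall>(y, y') \<in> \<theta>.
      (x \<squnion>\<^bsub>L\<^esub> y, x' \<squnion>\<^bsub>L\<^esub> y') \<in> \<theta> \<and> (\<Delta>\<^bsub>L\<^esub> x y, \<Delta>\<^bsub>L\<^esub> x' y') \<in> \<theta>)"

definition cubic_quotient :: "('a, 'm) cubic_scheme \<Rightarrow> ('a \<times> 'a) set \<Rightarrow> 'a set cubic"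
  where "cubic_quotient L \<theta> =
    \<lparr>carrier = carrier L // \<theta>,
     cone = \<theta> `` {\<one>\<^bsub>L\<^esub>},
     cjoin = (\<lambda>P Q. \<Union>x\<in>P. \<Union>y\<in>Q. \<theta> `` {x \<squnion>\<^bsub>L\<^esub> y}),
     delta = (\<lambda>P Q. \<Union>x\<in>P. \<Union>y\<in>Q. \<theta> `` {\<Delta>\<^bsub>L\<^esub> x y})\<rparr>"

text \<open>
  The free algebra is the algebra of all terms over \<open>X\<close> modulo the least congruence whose
  quotient is a cubic implication algebra.  See \<open>free_cubic_algebra\<close> and
  \<open>free_cubic_universal\<close> at the end for the universal property.
\<close>

definition free_cubic_congruence :: "'x set \<Rightarrow> ('x cubic_term \<times> 'x cubic_term) set"
  where "free_cubic_congruence X =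
    \<Inter> {\<theta>. cubic_congruence (cubic_terms X) \<theta> \<and>
          cubic_implication_algebra (cubic_quotient (cubic_terms X) \<theta>)}"

definition free_cubic :: "'x set \<Rightarrow> 'x cubic_term set cubic"  (\<open>\<F>r\<close>)
  where "\<F>r X = cubic_quotient (cubic_terms X) (free_cubic_congruence X)"

definition free_cubic_gen :: "'x set \<Rightarrow> 'x \<Rightarrow> 'x cubic_term set"
  where "free_cubic_gen X x = free_cubic_congruence X `` {CGen x}"


section \<open>Boolean algebras and Boolean algebras given by generators and relations\<close>

record 'b bool_struct = "'b partial_object" +
  bzero :: 'b  (\<open>\<bottom>\<index>\<close>)
  bone :: 'b  (\<open>\<top>\<index>\<close>)
  bmeet :: "'b \<Rightarrow> 'b \<Rightarrow> 'b"  (infixl \<open>\<curlywedge>\<index>\<close> 70)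
  bjoin :: "'b \<Rightarrow> 'b \<Rightarrow> 'b"  (infixl \<open>\<curlyvee>\<index>\<close> 65)
  bcompl :: "'b \<Rightarrow> 'b"  (\<open>\<ominus>\<index> _\<close> [81] 80)

text \<open>
  The axioms are those of the library's locale \<open>abstract_boolean_algebra\<close>, relativised to a
  carrier.  The one-element algebra is allowed.
\<close>

locale boolean_alg =
  fixes B :: "('b, 'm) bool_struct_scheme" (structure)
  assumes bzero_closed: "\<bottom> \<in> carrier B"
    and bone_closed: "\<top> \<in> carrier B"
    and bmeet_closed: "\<lbrakk>x \<in> carrier B; y \<in> carrier B\<rbrakk> \<Longrightarrow> x \<curlywedge> y \<in> carrier B"
    and bjoin_closed: "\<lbrakk>x \<in> carrier B; y \<in> carrier B\<rbrakk> \<Longrightarrow> x \<curlyvee> y \<in> carrier B"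
    and bcompl_closed: "x \<in> carrier B \<Longrightarrow> \<ominus> x \<in> carrier B"
    and bmeet_assoc: "\<lbrakk>x \<in> carrier B; y \<in> carrier B; z \<in> carrier B\<rbrakk>
      \<Longrightarrow> (x \<curlywedge> y) \<curlywedge> z = x \<curlywedge> (y \<curlywedge> z)"
    and bjoin_assoc: "\<lbrakk>x \<in> carrier B; y \<in> carrier B; z \<in> carrier B\<rbrakk>
      \<Longrightarrow> (x \<curlyvee> y) \<curlyvee> z = x \<curlyvee> (y \<curlyvee> z)"
    and bmeet_comm: "\<lbrakk>x \<in> carrier B; y \<in> carrier B\<rbrakk> \<Longrightarrow> x \<curlywedge> y = y \<curlywedge> x"
    and bjoin_comm: "\<lbrakk>x \<in> carrier B; y \<in> carrier B\<rbrakk> \<Longrightarrow> x \<curlyvee> y = y \<curlyvee> x"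
    and bmeet_bjoin_distrib: "\<lbrakk>x \<in> carrier B; y \<in> carrier B; z \<in> carrier B\<rbrakk>
      \<Longrightarrow> x \<curlywedge> (y \<curlyvee> z) = (x \<curlywedge> y) \<curlyvee> (x \<curlywedge> z)"
    and bjoin_bmeet_distrib: "\<lbrakk>x \<in> carrier B; y \<in> carrier B; z \<in> carrier B\<rbrakk>
      \<Longrightarrow> x \<curlyvee> (y \<curlywedge> z) = (x \<curlyvee> y) \<curlywedge> (x \<curlyvee> z)"
    and bmeet_bone: "x \<in> carrier B \<Longrightarrow> x \<curlywedge> \<top> = x"
    and bjoin_bzero: "x \<in> carrier B \<Longrightarrow> x \<curlyvee> \<bottom> = x"
    and bmeet_bcompl: "x \<in> carrier B \<Longrightarrow> x \<curlywedge> (\<ominus> x) = \<bottom>"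
    and bjoin_bcompl: "x \<in> carrier B \<Longrightarrow> x \<curlyvee> (\<ominus> x) = \<top>"

definition bool_congruence :: "('b, 'm) bool_struct_scheme \<Rightarrow> ('b \<times> 'b) set \<Rightarrow> bool"
  where "bool_congruence B \<theta> \<longleftrightarrow> equiv (carrier B) \<theta> \<and>
    (\<forall>(x, x') \<in> \<theta>. \<forall>(y, y') \<in> \<theta>.
      (x \<curlywedge>\<^bsub>B\<^esub> y, x' \<curlywedge>\<^bsub>B\<^esub> y') \<in> \<theta> \<and> (x \<curlyvee>\<^bsub>B\<^esub> y, x' \<curlyvee>\<^bsub>B\<^esub> y') \<in> \<theta>) \<and>
    (\<forall>(x, x') \<in> \<theta>. (\<ominus>\<^bsub>B\<^esub> x, \<ominus>\<^bsub>B\<^esub> x') \<in> \<theta>)"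

definition bool_quotient :: "('b, 'm) bool_struct_scheme \<Rightarrow> ('b \<times> 'b) set \<Rightarrow> 'b set bool_struct"
  where "bool_quotient B \<theta> =
    \<lparr>carrier = carrier B // \<theta>,
     bzero = \<theta> `` {\<bottom>\<^bsub>B\<^esub>},
     bone = \<theta> `` {\<top>\<^bsub>B\<^esub>},
     bmeet = (\<lambda>P Q. \<Union>x\<in>P. \<Union>y\<in>Q. \<theta> `` {x \<curlywedge>\<^bsub>B\<^esub> y}),
     bjoin = (\<lambda>P Q. \<Union>x\<in>P. \<Union>y\<in>Q. \<theta> `` {x \<curlyvee>\<^bsub>B\<^esub> y}),
     bcompl = (\<lambda>P. \<Union>x\<in>P. \<theta> `` {\<ominus>\<^bsub>B\<^esub> x})\<rparr>"

datatype (bgens: 'g) bool_term =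
    BGen 'g
  | BZero
  | BOne
  | BMeet "'g bool_term" "'g bool_term"
  | BJoin "'g bool_term" "'g bool_term"
  | BCompl "'g bool_term"

definition bool_terms :: "'g set \<Rightarrow> 'g bool_term bool_struct"
  where "bool_terms G =
    \<lparr>carrier = {p. bgens p \<subseteq> G}, bzero = BZero, bone = BOne,
     bmeet = BMeet, bjoin = BJoin, bcompl = BCompl\<rparr>"

definition free_bool_congruence :: "'g set \<Rightarrow> ('g bool_term \<times> 'g bool_term) set"
  where "free_bool_congruence G =
    \<Inter> {\<theta>. bool_congruence (bool_terms G) \<theta> \<and>
          boolean_alg (bool_quotient (bool_terms G) \<theta>)}"

definition free_bool :: "'g set \<Rightarrow> 'g bool_term set bool_struct"
  where "free_bool G = bool_quotient (bool_terms G) (free_bool_congruence G)"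

definition free_bool_gen :: "'g set \<Rightarrow> 'g \<Rightarrow> 'g bool_term set"
  where "free_bool_gen G g = free_bool_congruence G `` {BGen g}"

definition generated_bool_congruence ::
    "('b, 'm) bool_struct_scheme \<Rightarrow> ('b \<times> 'b) set \<Rightarrow> ('b \<times> 'b) set"
  where "generated_bool_congruence B R = \<Inter> {\<theta>. bool_congruence B \<theta> \<and> R \<subseteq> \<theta>}"


section \<open>Interval algebras\<close>

definition ble :: "('b, 'm) bool_struct_scheme \<Rightarrow> 'b \<Rightarrow> 'b \<Rightarrow> bool"  (infix \<open>\<preceq>\<index>\<close> 50)
  where "x \<preceq>\<^bsub>B\<^esub> y \<longleftrightarrow> x \<curlywedge>\<^bsub>B\<^esub> y = x"

text \<open>
  The interval \<open>[a, b]\<close> is the pair \<open>(a, b)\<close>.  The formula for \<open>\<Delta>\<close> applies when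
  its second argument lies in its first, so the first argument is replaced by the join.
\<close>

definition interval_join ::
    "('b, 'm) bool_struct_scheme \<Rightarrow> 'b \<times> 'b \<Rightarrow> 'b \<times> 'b \<Rightarrow> 'b \<times> 'b"
  where "interval_join B = (\<lambda>(a, b) (c, d). (a \<curlywedge>\<^bsub>B\<^esub> c, b \<curlyvee>\<^bsub>B\<^esub> d))"

definition interval_delta ::
    "('b, 'm) bool_struct_scheme \<Rightarrow> 'b \<times> 'b \<Rightarrow> 'b \<times> 'b \<Rightarrow> 'b \<times> 'b"
  where "interval_delta B = (\<lambda>(a, b) (c, d).
    (a \<curlyvee>\<^bsub>B\<^esub> (b \<curlywedge>\<^bsub>B\<^esub> (\<ominus>\<^bsub>B\<^esub> d)), b \<curlywedge>\<^bsub>B\<^esub> (a \<curlyvee>\<^bsub>B\<^esub> (\<ominus>\<^bsub>B\<^esub> c))))"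

definition interval_algebra :: "('b, 'm) bool_struct_scheme \<Rightarrow> ('b \<times> 'b) cubic"  (\<open>\<I>\<close>)
  where "\<I> B =
    \<lparr>carrier = {(a, b). a \<in> carrier B \<and> b \<in> carrier B \<and> a \<preceq>\<^bsub>B\<^esub> b},
     cone = (\<bottom>\<^bsub>B\<^esub>, \<top>\<^bsub>B\<^esub>),
     cjoin = interval_join B,
     delta = (\<lambda>x y. interval_delta B (interval_join B x y) y)\<rparr>"


section \<open>The algebras \<open>\<B> k\<close> and the union of localizations\<close>

datatype st_gen = SGen nat | TGen nat

definition st_gens :: "nat \<Rightarrow> st_gen set"
  where "st_gens k = SGen ` {..k} \<union> TGen ` {..k}"

primrec bjoin_upto :: "('b, 'm) bool_struct_scheme \<Rightarrow> (nat \<Rightarrow> 'b) \<Rightarrow> nat \<Rightarrow> 'b"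
  where
    "bjoin_upto B f 0 = \<bottom>\<^bsub>B\<^esub>"
  | "bjoin_upto B f (Suc n) = bjoin_upto B f n \<curlyvee>\<^bsub>B\<^esub> f (Suc n)"  \<comment> \<open>\<open>f 1 \<or> \<dots> \<or> f (n + 1)\<close>\<close>

text \<open>A relation \<open>x \<le> y\<close> is imposed as the pair \<open>(x \<curlywedge> y, x)\<close>.\<close>

definition st_relations :: "nat \<Rightarrow> (st_gen bool_term set \<times> st_gen bool_term set) set"
  where "st_relations k =
    (let F = free_bool (st_gens k);
         s = (\<lambda>i. free_bool_gen (st_gens k) (SGen i));
         t = (\<lambda>i. free_bool_gen (st_gens k) (TGen i));
         rel_le = (\<lambda>x y. (x \<curlywedge>\<^bsub>F\<^esub> y, x))
     in {(s 0, \<bottom>\<^bsub>F\<^esub>)}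
        \<union> {rel_le (s i) (t i) | i. i \<le> k}
        \<union> {rel_le (t 0) (bjoin_upto F s i \<curlyvee>\<^bsub>F\<^esub> t (i + 1)) | i. i < k}
        \<union> {rel_le (t 0) (bjoin_upto F s k)})"

definition st_congruence ::
    "nat \<Rightarrow> (st_gen bool_term set \<times> st_gen bool_term set) set"
  where "st_congruence k = generated_bool_congruence (free_bool (st_gens k)) (st_relations k)"

definition st_bool :: "nat \<Rightarrow> st_gen bool_term set set bool_struct"  (\<open>\<B>\<close>)
  where "\<B> k = bool_quotient (free_bool (st_gens k)) (st_congruence k)"

definition s_elem :: "nat \<Rightarrow> nat \<Rightarrow> st_gen bool_term set set"
  where "s_elem k i = st_congruence k `` {free_bool_gen (st_gens k) (SGen i)}"

definition t_elem :: "nat \<Rightarrow> nat \<Rightarrow> st_gen bool_term set set"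
  where "t_elem k i = st_congruence k `` {free_bool_gen (st_gens k) (TGen i)}"

definition union_localizations ::
    "nat \<Rightarrow> (st_gen bool_term set set \<times> st_gen bool_term set set) cubic"
  where "union_localizations k =
    (\<I> (\<B> k))\<lparr>carrier := \<Union>i\<le>k. localization (\<I> (\<B> k)) (s_elem k i, t_elem k i)\<rparr>"

section \<open>The universal property of \<open>\<F>r X\<close>\<close>

definition cubic_closed :: "('a, 'm) cubic_scheme \<Rightarrow> bool"
  where "cubic_closed L \<longleftrightarrow> \<one>\<^bsub>L\<^esub> \<in> carrier L \<and>
    (\<forall>x\<in>carrier L. \<forall>y\<in>carrier L. x \<squnion>\<^bsub>L\<^esub> y \<in> carrier L \<and> \<Delta>\<^bsub>L\<^esub> x y \<in> carrier L)"

lemma cubic_terms_simps [simp]: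
  "carrier (cubic_terms X) = {p. cgens p \<subseteq> X}"
  "\<one>\<^bsub>cubic_terms X\<^esub> = COne"
  "p \<squnion>\<^bsub>cubic_terms X\<^esub> q = CJoin p q"
  "\<Delta>\<^bsub>cubic_terms X\<^esub> p q = CDelta p q"
  by (simp_all add: cubic_terms_def)

lemma cubic_closed_terms: "cubic_closed (cubic_terms X)"
  by (simp add: cubic_closed_def)

lemma cubic_closed_algebra: "cubic_implication_algebra L \<Longrightarrow> cubic_closed L"
  by (simp add: cubic_closed_def cubic_implication_algebra.one_closed
      cubic_implication_algebra.join_closed cubic_implication_algebra.delta_closed)

lemma cubic_homD:
  assumes "h \<in> cubic_hom L M"
  shows "x \<in> carrier L \<Longrightarrow> h x \<in> carrier M"
    and "h \<one>\<^bsub>L\<^esub> = \<one>\<^bsub>M\<^esub>"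
    and "\<lbrakk>x \<in> carrier L; y \<in> carrier L\<rbrakk> \<Longrightarrow> h (x \<squnion>\<^bsub>L\<^esub> y) = h x \<squnion>\<^bsub>M\<^esub> h y"
    and "\<lbrakk>x \<in> carrier L; y \<in> carrier L\<rbrakk> \<Longrightarrow> h (\<Delta>\<^bsub>L\<^esub> x y) = \<Delta>\<^bsub>M\<^esub> (h x) (h y)"
  using assms by (auto simp: cubic_hom_def)

lemma cubic_implication_algebra_separated:
  fixes L :: "('a, 'm) cubic_scheme" and M :: "'i \<Rightarrow> ('b, 'n) cubic_scheme"
  assumes closed: "cubic_closed L"
    and alg: "\<And>i. i \<in> I \<Longrightarrow> cubic_implication_algebra (M i)"
    and hom: "\<And>i. i \<in> I \<Longrightarrow> h i \<in> cubic_hom L (M i)"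
    and sep: "\<And>x y. \<lbrakk>x \<in> carrier L; y \<in> carrier L; \<And>i. i \<in> I \<Longrightarrow> h i x = h i y\<rbrakk> \<Longrightarrow> x = y"
  shows "cubic_implication_algebra L"
proof -
  have c: "\<one>\<^bsub>L\<^esub> \<in> carrier L"
    "\<And>x y. \<lbrakk>x \<in> carrier L; y \<in> carrier L\<rbrakk> \<Longrightarrow> x \<squnion>\<^bsub>L\<^esub> y \<in> carrier L"
    "\<And>x y. \<lbrakk>x \<in> carrier L; y \<in> carrier L\<rbrakk> \<Longrightarrow> \<Delta>\<^bsub>L\<^esub> x y \<in> carrier L"
    using closed by (auto simp: cubic_closed_def)
  note h = cubic_homD [OF hom]
  have le: "h i x \<sqsubseteq>\<^bsub>M i\<^esub> h i y"
    if "i \<in> I" "x \<in> carrier L" "y \<in> carrier L" "x \<sqsubseteq>\<^bsub>L\<^esub> y" for i x y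
    using that h(3) [OF that(1-3)] by (simp add: cle_def)
  have p: "h i (x \<odot>\<^bsub>L\<^esub> y) = h i x \<odot>\<^bsub>M i\<^esub> h i y"
    if "i \<in> I" "x \<in> carrier L" "y \<in> carrier L" for i x y
    using that by (simp add: cprod_def h c)
  have pc: "x \<odot>\<^bsub>L\<^esub> y \<in> carrier L" if "x \<in> carrier L" "y \<in> carrier L" for x y
    using that by (simp add: cprod_def c)
  have leI: "x \<sqsubseteq>\<^bsub>L\<^esub> y"
    if "x \<in> carrier L" "y \<in> carrier L" "\<And>i. i \<in> I \<Longrightarrow> h i x \<sqsubseteq>\<^bsub>M i\<^esub> h i y" for x y
    unfolding cle_def by (rule sep) (use that in \<open>simp_all add: h c cle_def\<close>)
  note ax = cubic_implication_algebra.join_assoc [OF alg]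
    cubic_implication_algebra.join_comm [OF alg]
    cubic_implication_algebra.join_idem [OF alg]
    cubic_implication_algebra.one_greatest [OF alg]
    cubic_implication_algebra.delta_total [OF alg]
    cubic_implication_algebra.delta_join [OF alg]
    cubic_implication_algebra.delta_delta [OF alg]
    cubic_implication_algebra.delta_involution [OF alg]
    cubic_implication_algebra.delta_mono [OF alg]
    cubic_implication_algebra.prod_prod [OF alg]
    cubic_implication_algebra.prod_exchange [OF alg]
  show ?thesis
  proof
    show "\<one>\<^bsub>L\<^esub> \<in> carrier L" "\<lbrakk>x \<in> carrier L; y \<in> carrier L\<rbrakk> \<Longrightarrow> x \<squnion>\<^bsub>L\<^esub> y \<in> carrier L"
      "\<lbrakk>x \<in> carrier L; y \<in> carrier L\<rbrakk> \<Longrightarrow> \<Delta>\<^bsub>L\<^esub> x y \<in> carrier L" for x y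
      by (simp_all add: c)
    show "(x \<squnion>\<^bsub>L\<^esub> y) \<squnion>\<^bsub>L\<^esub> z = x \<squnion>\<^bsub>L\<^esub> (y \<squnion>\<^bsub>L\<^esub> z)" if "x \<in> carrier L" "y \<in> carrier L" "z \<in> carrier L"  for x y z
      by (rule sep; (simp add: h c p pc that)?) (rule ax; simp add: h c le that)
    show "x \<squnion>\<^bsub>L\<^esub> y = y \<squnion>\<^bsub>L\<^esub> x" if "x \<in> carrier L" "y \<in> carrier L"  for x y
      by (rule sep; (simp add: h c p pc that)?) (rule ax; simp add: h c le that)
    show "x \<squnion>\<^bsub>L\<^esub> x = x" if "x \<in> carrier L"  for x
      by (rule sep; (simp add: h c p pc that)?) (rule ax; simp add: h c le that)
    show "x \<sqsubseteq>\<^bsub>L\<^esub> \<one>\<^bsub>L\<^esub>" if "x \<in> carrier L"  for x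
      by (rule leI; (simp add: h c p pc that)?) (rule ax; simp add: h c le that)
    show "\<Delta>\<^bsub>L\<^esub> x y = \<Delta>\<^bsub>L\<^esub> (x \<squnion>\<^bsub>L\<^esub> y) y" if "x \<in> carrier L" "y \<in> carrier L"  for x y
      by (rule sep; (simp add: h c p pc that)?) (rule ax; simp add: h c le that)
    show "\<Delta>\<^bsub>L\<^esub> y x \<squnion>\<^bsub>L\<^esub> x = y" if "x \<in> carrier L" "y \<in> carrier L" "x \<sqsubseteq>\<^bsub>L\<^esub> y" for x y
      by (rule sep; (simp add: h c p pc that)?) (rule ax; simp add: h c le that)
    show "\<Delta>\<^bsub>L\<^esub> z (\<Delta>\<^bsub>L\<^esub> y x) = \<Delta>\<^bsub>L\<^esub> (\<Delta>\<^bsub>L\<^esub> z y) (\<Delta>\<^bsub>L\<^esub> z x)" if "x \<in> carrier L" "y \<in> carrier L" "z \<in> carrier L" "x \<sqsubseteq>\<^bsub>L\<^esub> y" "y \<sqsubseteq>\<^bsub>L\<^esub> z" for x y z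
      by (rule sep; (simp add: h c p pc that)?) (rule ax; simp add: h c le that)
    show "\<Delta>\<^bsub>L\<^esub> y (\<Delta>\<^bsub>L\<^esub> y x) = x" if "x \<in> carrier L" "y \<in> carrier L" "x \<sqsubseteq>\<^bsub>L\<^esub> y" for x y
      by (rule sep; (simp add: h c p pc that)?) (rule ax; simp add: h c le that)
    show "\<Delta>\<^bsub>L\<^esub> z x \<sqsubseteq>\<^bsub>L\<^esub> \<Delta>\<^bsub>L\<^esub> z y" if "x \<in> carrier L" "y \<in> carrier L" "z \<in> carrier L" "x \<sqsubseteq>\<^bsub>L\<^esub> y" "y \<sqsubseteq>\<^bsub>L\<^esub> z" for x y z
      by (rule leI; (simp add: h c p pc that)?) (rule ax; simp add: h c le that)
    show "(x \<odot>\<^bsub>L\<^esub> y) \<odot>\<^bsub>L\<^esub> y = x \<squnion>\<^bsub>L\<^esub> y" if "x \<in> carrier L" "y \<in> carrier L"  for x y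
      by (rule sep; (simp add: h c p pc that)?) (rule ax; simp add: h c le that)
    show "x \<odot>\<^bsub>L\<^esub> (y \<odot>\<^bsub>L\<^esub> z) = y \<odot>\<^bsub>L\<^esub> (x \<odot>\<^bsub>L\<^esub> z)" if "x \<in> carrier L" "y \<in> carrier L" "z \<in> carrier L"  for x y z
      by (rule sep; (simp add: h c p pc that)?) (rule ax; simp add: h c le that)
  qed
qed

lemma cubic_quotient_simps:
  assumes "cubic_congruence L \<theta>"
  shows "carrier (cubic_quotient L \<theta>) = carrier L // \<theta>"
    and "\<one>\<^bsub>cubic_quotient L \<theta>\<^esub> = \<theta> `` {\<one>\<^bsub>L\<^esub>}"
    and "\<lbrakk>x \<in> carrier L; y \<in> carrier L\<rbrakk>
      \<Longrightarrow> \<theta> `` {x} \<squnion>\<^bsub>cubic_quotient L \<theta>\<^esub> \<theta> `` {y} = \<theta> `` {x \<squnion>\<^bsub>L\<^esub> y}"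
    and "\<lbrakk>x \<in> carrier L; y \<in> carrier L\<rbrakk>
      \<Longrightarrow> \<Delta>\<^bsub>cubic_quotient L \<theta>\<^esub> (\<theta> `` {x}) (\<theta> `` {y}) = \<theta> `` {\<Delta>\<^bsub>L\<^esub> x y}"
proof -
  have eq: "equiv (carrier L) \<theta>"
    using assms by (simp add: cubic_congruence_def)
  show "carrier (cubic_quotient L \<theta>) = carrier L // \<theta>"
    and "\<one>\<^bsub>cubic_quotient L \<theta>\<^esub> = \<theta> `` {\<one>\<^bsub>L\<^esub>}"
    by (simp_all add: cubic_quotient_def)
  have j: "congruent2 \<theta> \<theta> (\<lambda>x y. \<theta> `` {x \<squnion>\<^bsub>L\<^esub> y})"
    and d: "congruent2 \<theta> \<theta> (\<lambda>x y. \<theta> `` {\<Delta>\<^bsub>L\<^esub> x y})"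
    using assms unfolding cubic_congruence_def congruent2_def
    by (auto simp: case_prod_unfold intro!: equiv_class_eq [OF eq])
  show "\<theta> `` {x} \<squnion>\<^bsub>cubic_quotient L \<theta>\<^esub> \<theta> `` {y} = \<theta> `` {x \<squnion>\<^bsub>L\<^esub> y}"
    "\<Delta>\<^bsub>cubic_quotient L \<theta>\<^esub> (\<theta> `` {x}) (\<theta> `` {y}) = \<theta> `` {\<Delta>\<^bsub>L\<^esub> x y}"
    if "x \<in> carrier L" "y \<in> carrier L" for x y
    using UN_equiv_class2 [OF eq eq j that] UN_equiv_class2 [OF eq eq d that]
    by (simp_all add: cubic_quotient_def)
qed

lemma cubic_closed_quotient:
  assumes "cubic_closed L" "cubic_congruence L \<theta>"
  shows "cubic_closed (cubic_quotient L \<theta>)"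
  using assms(1)
  by (auto simp: cubic_closed_def cubic_quotient_simps [OF assms(2)]
      intro!: quotientI elim!: quotientE)

lemma cubic_quotient_hom:
  assumes "cubic_congruence L \<theta>"
  shows "(\<lambda>x. \<theta> `` {x}) \<in> cubic_hom L (cubic_quotient L \<theta>)"
  by (auto simp: cubic_hom_def cubic_quotient_simps [OF assms] intro: quotientI)

lemma cubic_induced:
  assumes closed: "cubic_closed L" and cong: "cubic_congruence L \<theta>" and f: "f \<in> cubic_hom L M"
    and ker: "\<And>x y. (x, y) \<in> \<theta> \<Longrightarrow> f x = f y"
  defines "g \<equiv> \<lambda>P. the_elem (f ` P)"
  shows cubic_induced_class: "x \<in> carrier L \<Longrightarrow> g (\<theta> `` {x}) = f x"
    and cubic_induced_hom: "g \<in> cubic_hom (cubic_quotient L \<theta>) M"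
proof -
  have eq: "equiv (carrier L) \<theta>"
    using cong by (simp add: cubic_congruence_def)
  note Q = cubic_quotient_simps [OF cong]
  have *: "g (\<theta> `` {x}) = f x" if "x \<in> carrier L" for x
  proof -
    have "f ` (\<theta> `` {x}) = {f x}"
    proof (rule equalityI)
      show "f ` (\<theta> `` {x}) \<subseteq> {f x}"
        using ker [symmetric] by blast
      show "{f x} \<subseteq> f ` (\<theta> `` {x})"
        using equiv_class_self [OF eq that] by blast
    qed
    then show ?thesis
      by (simp add: g_def)
  qed
  then show "x \<in> carrier L \<Longrightarrow> g (\<theta> `` {x}) = f x" .
  show "g \<in> cubic_hom (cubic_quotient L \<theta>) M"
    unfolding cubic_hom_def
  proof (intro CollectI conjI ballI funcsetI)
    have rep: "\<exists>x\<in>carrier L. P = \<theta> `` {x}" if "P \<in> carrier (cubic_quotient L \<theta>)" for P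
      using that unfolding Q(1) by (rule quotientE) blast
    show "g \<one>\<^bsub>cubic_quotient L \<theta>\<^esub> = \<one>\<^bsub>M\<^esub>"
      using closed by (simp add: Q(2) * cubic_closed_def cubic_homD(2) [OF f])
    fix P assume "P \<in> carrier (cubic_quotient L \<theta>)"
    then obtain x where x: "x \<in> carrier L" "P = \<theta> `` {x}"
      using rep by blast
    then show "g P \<in> carrier M"
      by (simp add: * cubic_homD(1) [OF f])
    fix R assume "R \<in> carrier (cubic_quotient L \<theta>)"
    then obtain y where y: "y \<in> carrier L" "R = \<theta> `` {y}"
      using rep by blast
    show "g (P \<squnion>\<^bsub>cubic_quotient L \<theta>\<^esub> R) = g P \<squnion>\<^bsub>M\<^esub> g R"
      "g (\<Delta>\<^bsub>cubic_quotient L \<theta>\<^esub> P R) = \<Delta>\<^bsub>M\<^esub> (g P) (g R)"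
      using closed x y by (simp_all add: Q * cubic_closed_def cubic_homD [OF f])
  qed
qed

lemma free_cubic_congruence: "cubic_congruence (cubic_terms X) (free_cubic_congruence X)"
proof -
  let ?good = "\<lambda>\<theta>. cubic_congruence (cubic_terms X) \<theta> \<and>
    cubic_implication_algebra (cubic_quotient (cubic_terms X) \<theta>)"
  let ?all = "carrier (cubic_terms X) \<times> carrier (cubic_terms X)"
  have *: "cubic_congruence (cubic_terms X) ?all"
    by (auto simp: cubic_congruence_def equiv_def refl_on_def sym_def trans_def)
  have "cubic_implication_algebra (cubic_quotient (cubic_terms X) ?all)"
    by (rule cubic_implication_algebra_separated
        [where I = "{}" and M = "\<lambda>_. undefined" and h = "\<lambda>_. undefined"])
      (use * in \<open>auto simp: cubic_closed_quotient cubic_closed_terms cubic_quotient_simps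
        elim!: quotientE\<close>)
  with * have all: "?good ?all" ..
  have eq: "equiv (carrier (cubic_terms X)) \<theta>" if "?good \<theta>" for \<theta>
    using that by (simp add: cubic_congruence_def)
  have "equiv (carrier (cubic_terms X)) (free_cubic_congruence X)"
  proof (rule equivI)
    show "free_cubic_congruence X \<subseteq> ?all"
      using all unfolding free_cubic_congruence_def by blast
    show "refl_on (carrier (cubic_terms X)) (free_cubic_congruence X)"
      using eq by (auto simp: free_cubic_congruence_def equiv_def refl_on_def)
    show "sym (free_cubic_congruence X)"
    proof (rule symI)
      fix x y
      assume xy: "(x, y) \<in> free_cubic_congruence X"
      have "(y, x) \<in> \<theta>" if "?good \<theta>" for \<theta>
      proof -
        have "(x, y) \<in> \<theta>"
          using xy that unfolding free_cubic_congruence_def by blast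
        then show ?thesis
          using eq [OF that] by (meson equivE symD)
      qed
      then show "(y, x) \<in> free_cubic_congruence X"
        unfolding free_cubic_congruence_def by blast
    qed
    show "trans (free_cubic_congruence X)"
    proof (rule transI)
      fix x y z
      assume xyz: "(x, y) \<in> free_cubic_congruence X" "(y, z) \<in> free_cubic_congruence X"
      have "(x, z) \<in> \<theta>" if "?good \<theta>" for \<theta>
      proof -
        have "(x, y) \<in> \<theta>" "(y, z) \<in> \<theta>"
          using xyz that unfolding free_cubic_congruence_def by blast+
        then show ?thesis
          using eq [OF that] by (meson equivE transD)
      qed
      then show "(x, z) \<in> free_cubic_congruence X"
        unfolding free_cubic_congruence_def by blast
    qed
  qed
  moreover have "(CJoin x y, CJoin x' y') \<in> free_cubic_congruence X"
    "(CDelta x y, CDelta x' y') \<in> free_cubic_congruence X"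
    if "(x, x') \<in> free_cubic_congruence X" "(y, y') \<in> free_cubic_congruence X" for x x' y y'
  proof -
    have "(CJoin x y, CJoin x' y') \<in> \<theta> \<and> (CDelta x y, CDelta x' y') \<in> \<theta>" if good: "?good \<theta>" for \<theta>
    proof -
      have "(x, x') \<in> \<theta>" "(y, y') \<in> \<theta>"
        using that \<open>(x, x') \<in> _\<close> \<open>(y, y') \<in> _\<close> unfolding free_cubic_congruence_def by blast+
      with good show ?thesis
        unfolding cubic_congruence_def by fastforce
    qed
    then show "(CJoin x y, CJoin x' y') \<in> free_cubic_congruence X"
      "(CDelta x y, CDelta x' y') \<in> free_cubic_congruence X"
      unfolding free_cubic_congruence_def by blast+
  qed
  ultimately show ?thesis
    unfolding cubic_congruence_def by auto
qed

theorem free_cubic_algebra: "cubic_implication_algebra (\<F>r X)"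
proof -
  let ?T = "cubic_terms X" and ?\<Theta> = "free_cubic_congruence X"
  define I where "I = {\<theta>. cubic_congruence ?T \<theta> \<and> cubic_implication_algebra (cubic_quotient ?T \<theta>)}"
  let ?h = "\<lambda>\<theta> P. the_elem ((\<lambda>x. \<theta> `` {x}) ` P)"
  have cong: "cubic_congruence ?T \<theta>" if "\<theta> \<in> I" for \<theta>
    using that by (simp add: I_def)
  have eq: "\<theta> `` {x} = \<theta> `` {y} \<longleftrightarrow> (x, y) \<in> \<theta>"
    if "cubic_congruence ?T \<theta>" "x \<in> carrier ?T" "y \<in> carrier ?T" for \<theta> x y
    by (rule eq_equiv_class_iff [OF _ that(2,3)]) (use that(1) in \<open>simp only: cubic_congruence_def\<close>)
  have ker: "\<theta> `` {x} = \<theta> `` {y}" if "\<theta> \<in> I" "(x, y) \<in> ?\<Theta>" for \<theta> x y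
  proof (rule equiv_class_eq)
    show "equiv (carrier ?T) \<theta>"
      using cong [OF that(1)] by (simp add: cubic_congruence_def)
    show "(x, y) \<in> \<theta>"
      using that by (auto simp: free_cubic_congruence_def I_def)
  qed
  have ind: "?h \<theta> (?\<Theta> `` {x}) = \<theta> `` {x}" if "\<theta> \<in> I" "x \<in> carrier ?T" for \<theta> x
    by (rule cubic_induced_class [OF cubic_closed_terms free_cubic_congruence
        cubic_quotient_hom [OF cong [OF that(1)]] ker [OF that(1)] that(2)])
  show ?thesis
    unfolding free_cubic_def
  proof (rule cubic_implication_algebra_separated [where I = I and h = ?h])
    show "cubic_closed (cubic_quotient ?T ?\<Theta>)"
      by (rule cubic_closed_quotient [OF cubic_closed_terms free_cubic_congruence])
    show "cubic_implication_algebra (cubic_quotient ?T \<theta>)" if "\<theta> \<in> I" for \<theta>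
      using that by (simp add: I_def)
    show "?h \<theta> \<in> cubic_hom (cubic_quotient ?T ?\<Theta>) (cubic_quotient ?T \<theta>)" if "\<theta> \<in> I" for \<theta>
      by (rule cubic_induced_hom [OF cubic_closed_terms free_cubic_congruence
          cubic_quotient_hom [OF cong [OF that]] ker [OF that]])
    fix P Q
    assume PQ: "P \<in> carrier (cubic_quotient ?T ?\<Theta>)" "Q \<in> carrier (cubic_quotient ?T ?\<Theta>)"
      and same: "\<And>\<theta>. \<theta> \<in> I \<Longrightarrow> ?h \<theta> P = ?h \<theta> Q"
    obtain p q where p: "p \<in> carrier ?T" "P = ?\<Theta> `` {p}" and q: "q \<in> carrier ?T" "Q = ?\<Theta> `` {q}"
      using PQ unfolding cubic_quotient_simps [OF free_cubic_congruence]
      by (auto elim!: quotientE)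
    have "(p, q) \<in> \<theta>" if "\<theta> \<in> I" for \<theta>
    proof -
      have "\<theta> `` {p} = \<theta> `` {q}"
        using same [OF that] ind [OF that p(1)] ind [OF that q(1)] p q by simp
      then show ?thesis
        using eq [OF cong [OF that] p(1) q(1)] by simp
    qed
    then have "(p, q) \<in> ?\<Theta>"
      by (auto simp: free_cubic_congruence_def I_def)
    then show "P = Q"
      using eq [OF free_cubic_congruence p(1) q(1)] p q by simp
  qed
qed

primrec cubic_eval :: "('a, 'm) cubic_scheme \<Rightarrow> ('x \<Rightarrow> 'a) \<Rightarrow> 'x cubic_term \<Rightarrow> 'a"
  where
    "cubic_eval M f (CGen x) = f x"
  | "cubic_eval M f COne = \<one>\<^bsub>M\<^esub>"
  | "cubic_eval M f (CJoin p q) = cubic_eval M f p \<squnion>\<^bsub>M\<^esub> cubic_eval M f q"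
  | "cubic_eval M f (CDelta p q) = \<Delta>\<^bsub>M\<^esub> (cubic_eval M f p) (cubic_eval M f q)"

lemma cubic_eval_hom:
  assumes "cubic_closed M" "f \<in> X \<rightarrow> carrier M"
  shows "cubic_eval M f \<in> cubic_hom (cubic_terms X) M"
proof -
  have "cgens p \<subseteq> X \<Longrightarrow> cubic_eval M f p \<in> carrier M" for p
    using assms by (induction p) (auto simp: cubic_closed_def)
  then show ?thesis
    by (auto simp: cubic_hom_def)
qed

lemma cubic_eval_free_congruence:
  assumes M: "cubic_implication_algebra M" and f: "f \<in> X \<rightarrow> carrier M"
    and pq: "(p, q) \<in> free_cubic_congruence X"
  shows "cubic_eval M f p = cubic_eval M f q"
proof -
  let ?T = "cubic_terms X" and ?e = "cubic_eval M f"
  let ?\<theta> = "{(p, q). p \<in> carrier ?T \<and> q \<in> carrier ?T \<and> ?e p = ?e q}"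
  have hom: "?e \<in> cubic_hom ?T M"
    by (rule cubic_eval_hom [OF cubic_closed_algebra [OF M] f])
  have eq: "equiv (carrier ?T) ?\<theta>"
    by (auto simp: equiv_def refl_on_def sym_def trans_def)
  have cong: "cubic_congruence ?T ?\<theta>"
    using eq by (auto simp: cubic_congruence_def)
  note ind = cubic_induced [OF cubic_closed_terms cong hom]
  have "cubic_implication_algebra (cubic_quotient ?T ?\<theta>)"
  proof (rule cubic_implication_algebra_separated [where I = "{()}" and M = "\<lambda>_. M"
        and h = "\<lambda>_ P. the_elem (?e ` P)"])
    show "cubic_closed (cubic_quotient ?T ?\<theta>)"
      by (rule cubic_closed_quotient [OF cubic_closed_terms cong])
    show "cubic_implication_algebra M"
      by (rule M)
    show "(\<lambda>P. the_elem (?e ` P)) \<in> cubic_hom (cubic_quotient ?T ?\<theta>) M"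
      by (rule ind(2)) simp
    fix P Q
    assume PQ: "P \<in> carrier (cubic_quotient ?T ?\<theta>)" "Q \<in> carrier (cubic_quotient ?T ?\<theta>)"
      and same: "\<And>i. i \<in> {()} \<Longrightarrow> the_elem (?e ` P) = the_elem (?e ` Q)"
    obtain p q where p: "p \<in> carrier ?T" "P = ?\<theta> `` {p}" and q: "q \<in> carrier ?T" "Q = ?\<theta> `` {q}"
      using PQ unfolding cubic_quotient_simps [OF cong] by (elim quotientE) blast
    have "the_elem (?e ` P) = ?e p" "the_elem (?e ` Q) = ?e q"
      unfolding p(2) q(2) by (rule ind(1); use p(1) q(1) in simp)+
    then have "(p, q) \<in> ?\<theta>"
      using same p(1) q(1) by simp
    then show "P = Q"
      unfolding p(2) q(2) by (rule equiv_class_eq [OF eq])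
  qed
  with cong have "free_cubic_congruence X \<subseteq> ?\<theta>"
    unfolding free_cubic_congruence_def by blast
  with pq show ?thesis by blast
qed

theorem free_cubic_universal:
  assumes M: "cubic_implication_algebra M" and f: "f \<in> X \<rightarrow> carrier M"
  shows "\<exists>h \<in> cubic_hom (\<F>r X) M. \<forall>x\<in>X. h (free_cubic_gen X x) = f x"
    and "\<lbrakk>h \<in> cubic_hom (\<F>r X) M; h' \<in> cubic_hom (\<F>r X) M;
      \<forall>x\<in>X. h (free_cubic_gen X x) = h' (free_cubic_gen X x); P \<in> carrier (\<F>r X)\<rbrakk>
      \<Longrightarrow> h P = h' P"
proof -
  note ind = cubic_induced [OF cubic_closed_terms free_cubic_congruence
      cubic_eval_hom [OF cubic_closed_algebra [OF M] f] cubic_eval_free_congruence [OF M f],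
      folded free_cubic_def]
  show "\<exists>h \<in> cubic_hom (\<F>r X) M. \<forall>x\<in>X. h (free_cubic_gen X x) = f x"
    by (rule bexI [OF _ ind(2)]) (auto simp: free_cubic_gen_def ind(1))
next
  assume h: "h \<in> cubic_hom (\<F>r X) M" and h': "h' \<in> cubic_hom (\<F>r X) M"
    and eq: "\<forall>x\<in>X. h (free_cubic_gen X x) = h' (free_cubic_gen X x)"
    and P: "P \<in> carrier (\<F>r X)"
  let ?c = "\<lambda>p. free_cubic_congruence X `` {p}"
  note Q = cubic_quotient_simps [OF free_cubic_congruence [of X], folded free_cubic_def]
  have mem: "?c p \<in> carrier (\<F>r X)" if "cgens p \<subseteq> X" for p
    using that by (auto simp: Q intro: quotientI)
  have "h (?c p) = h' (?c p)" if "cgens p \<subseteq> X" for p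
    using that
  proof (induction p)
    case (CGen x)
    then show ?case using eq by (simp add: free_cubic_gen_def)
  next
    case COne
    then show ?case using cubic_homD(2) [OF h] cubic_homD(2) [OF h'] by (simp add: Q)
  next
    case (CJoin p q)
    then show ?case
      using cubic_homD(3) [OF h mem mem, of p q] cubic_homD(3) [OF h' mem mem, of p q]
      by (simp add: Q)
  next
    case (CDelta p q)
    then show ?case
      using cubic_homD(4) [OF h mem mem, of p q] cubic_homD(4) [OF h' mem mem, of p q]
      by (simp add: Q)
  qed
  with P show "h P = h' P"
    by (auto simp: Q elim!: quotientE)
qed

end

theory Submission
  imports Defs
begin

text \<open>
  Both algebras are subalgebras of powers of the three-element algebra \<open>\<I> 2\<close>, the
  intervals of the two-element Boolean algebra.  Its elements are the two vertices \<open>[0, 0]\<close>,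
  \<open>[1, 1]\<close> and the edge \<open>[0, 1] = \<one>\<close> of a segment.

  For the free algebra this is a representation theorem: in every cubic implication algebra the
  homomorphisms to \<open>\<I> 2\<close> separate points (\<open>separated_by_coordinates\<close>).  The product
  \<open>x \<odot> y\<close> is an implication, so if \<open>x\<close> is not below \<open>y\<close>, then some prime filter \<open>F\<close> omits
  \<open>x \<odot> y\<close>, and thus contains \<open>x\<close> but not \<open>y\<close>; sending an element to \<open>[0, 0]\<close> if it is
  outside \<open>F\<close>, to \<open>[1, 1]\<close> if its reflection \<open>\<Delta> \<one> x\<close> is outside \<open>F\<close>, and to the edge otherwise,
  is a homomorphism.  A homomorphism from the free algebra to \<open>\<I> 2\<close> is an arbitrary assignment of
  the three elements to the generators.

  The elements of \<open>\<B> k\<close> are separated by its two-valued homomorphisms, the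
  valuations (\<open>st_bool_valuations_separate\<close>), and a valuation of \<open>\<B> k\<close>
  amounts to an assignment of values \<open>[s_i, t_i]\<close> in \<open>\<I> 2\<close> satisfying
  the defining relations. These relations say that some value is not the edge, and that the first
  value that is not the edge is \<open>[0, 0]\<close> when its index is \<open>0\<close> and
  \<open>[1, 1]\<close> when its index is positive. Exchanging the two vertices is an automorphism
  of \<open>\<I> 2\<close>, and of each assignment that takes some value other than the edge and its
  mirror image exactly one satisfies the relations. Hence the homomorphism from the free algebra
  sending \<open>a_i\<close> to \<open>[s_i, t_i]\<close> is injective: whatever separates two
  elements of the free algebra can be reflected, if necessary, into a valuation of
  \<open>\<B> k\<close>.

  It remains that the intervals \<open>[s_i, t_i]\<close> generate the union of their localizations
  (\<open>st_intervals_generate\<close>).  An element of the localization at \<open>g = [s_i, t_i]\<close> is \<open>\<Delta> y x\<close>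
  with \<open>x\<close>, \<open>y\<close> above \<open>g\<close>, and an element above \<open>g\<close> arises from \<open>g\<close> by making it an
  edge on some \<open>b\<close> in \<open>\<B> k\<close>.  The \<open>b\<close> for which the result is generated form a Boolean
  subalgebra, so it has to contain every \<open>s_j\<close> and \<open>t_j\<close>.  Joining \<open>g\<close> with \<open>[s_j, t_j]\<close> and
  with its reflection tells where \<open>[s_j, t_j]\<close> is the same vertex as \<open>g\<close> and where it is the
  opposite one; comparing \<open>g\<close> in this way with the first interval that is not an edge, whose vertex
  is prescribed by the relations, tells which vertex \<open>g\<close> itself is.
\<close>


section \<open>The three-element interval algebra\<close>

definition two_bool :: "bool bool_struct"
  where "two_bool = \<lparr>carrier = UNIV, bzero = False, bone = True, bmeet = (\<and>), bjoin = (\<or>), bcompl = Not\<rparr>"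

lemma interval_two_simps [simp]:
  "carrier (\<I> two_bool) = {(a, b). a \<longrightarrow> b}"
  "\<one>\<^bsub>\<I> two_bool\<^esub> = (False, True)"
  "(a, b) \<squnion>\<^bsub>\<I> two_bool\<^esub> (c, d) = (a \<and> c, b \<or> d)"
  "\<Delta>\<^bsub>\<I> two_bool\<^esub> (a, b) (c, d)
    = (a \<and> c \<or> (b \<or> d) \<and> \<not> d, (b \<or> d) \<and> (a \<and> c \<or> \<not> c))"
  by (auto simp: interval_algebra_def two_bool_def interval_join_def interval_delta_def ble_def)

lemma cubic_interval_two: "cubic_implication_algebra (\<I> two_bool)"
  by unfold_locales (auto simp: cle_def cprod_def)

lemma cubic_hom_compose:
  "\<lbrakk>f \<in> cubic_hom L M; g \<in> cubic_hom M N\<rbrakk> \<Longrightarrow> g \<circ> f \<in> cubic_hom L N"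
  by (simp add: cubic_hom_def Pi_iff)

lemma interval_two_cases:
  "p \<in> carrier (\<I> two_bool) \<Longrightarrow> p = (False, False) \<or> p = (True, True) \<or> p = (False, True)"
  by auto

text \<open>
  Exchanging the two vertices is what allows an arbitrary assignment of values in \<open>\<I> 2\<close> to be
  normalized.
\<close>
lemma flip_hom: "(\<lambda>(a, b). (\<not> b, \<not> a)) \<in> cubic_hom (\<I> two_bool) (\<I> two_bool)"
  by (auto simp: cubic_hom_def)


section \<open>Coordinates of a cubic implication algebra\<close>

context cubic_implication_algebra
begin

lemma le_refl: "x \<in> carrier L \<Longrightarrow> x \<sqsubseteq> x"
  by (simp add: cle_def join_idem)

lemma le_antisym: "\<lbrakk>x \<in> carrier L; y \<in> carrier L; x \<sqsubseteq> y; y \<sqsubseteq> x\<rbrakk> \<Longrightarrow> x = y"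
  using join_comm by (force simp: cle_def)

lemma le_trans:
  "\<lbrakk>x \<in> carrier L; y \<in> carrier L; z \<in> carrier L; x \<sqsubseteq> y; y \<sqsubseteq> z\<rbrakk> \<Longrightarrow> x \<sqsubseteq> z"
  using join_assoc [of x y z] by (simp add: cle_def)

lemma join_upper1: "\<lbrakk>x \<in> carrier L; y \<in> carrier L\<rbrakk> \<Longrightarrow> x \<sqsubseteq> x \<squnion> y"
  using join_assoc [of x x y] by (simp add: cle_def join_idem)

lemma join_upper2: "\<lbrakk>x \<in> carrier L; y \<in> carrier L\<rbrakk> \<Longrightarrow> y \<sqsubseteq> x \<squnion> y"
  using join_upper1 [of y x] by (simp add: join_comm)

lemma join_least:
  "\<lbrakk>x \<in> carrier L; y \<in> carrier L; z \<in> carrier L; x \<sqsubseteq> z; y \<sqsubseteq> z\<rbrakk> \<Longrightarrow> x \<squnion> y \<sqsubseteq> z"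
  using join_assoc [of x y z] by (simp add: cle_def)

lemma one_le_iff: "x \<in> carrier L \<Longrightarrow> \<one> \<sqsubseteq> x \<longleftrightarrow> x = \<one>"
  using le_antisym le_refl one_closed one_greatest by blast

lemma delta_le: "\<lbrakk>x \<in> carrier L; y \<in> carrier L; x \<sqsubseteq> y\<rbrakk> \<Longrightarrow> \<Delta> y x \<sqsubseteq> y"
  using join_upper1 [of "\<Delta> y x" x] by (simp add: delta_join delta_closed)

lemma delta_self:
  assumes "x \<in> carrier L"
  shows "\<Delta> x x = x"
proof (rule le_antisym)
  show "\<Delta> x x \<sqsubseteq> x" using assms by (simp add: delta_le le_refl)
  then have "\<Delta> x (\<Delta> x x) \<sqsubseteq> \<Delta> x x"
    using assms by (intro delta_mono) (auto simp: delta_closed le_refl)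
  then show "x \<sqsubseteq> \<Delta> x x" using assms by (simp add: delta_involution le_refl)
qed (use assms in \<open>auto simp: delta_closed\<close>)

lemma reflect_reflect: "x \<in> carrier L \<Longrightarrow> \<Delta> \<one> (\<Delta> \<one> x) = x"
  by (simp add: delta_involution one_closed one_greatest)

lemma reflect_le_iff:
  "\<lbrakk>x \<in> carrier L; y \<in> carrier L\<rbrakk> \<Longrightarrow> \<Delta> \<one> x \<sqsubseteq> \<Delta> \<one> y \<longleftrightarrow> x \<sqsubseteq> y"
  using delta_mono [of x y \<one>] delta_mono [of "\<Delta> \<one> x" "\<Delta> \<one> y" \<one>]
  by (auto simp: reflect_reflect delta_closed one_closed one_greatest)

lemma reflect_join:
  assumes "x \<in> carrier L" "y \<in> carrier L"
  shows "\<Delta> \<one> (x \<squnion> y) = \<Delta> \<one> x \<squnion> \<Delta> \<one> y"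
proof (rule le_antisym)
  let ?u = "\<Delta> \<one> x \<squnion> \<Delta> \<one> y"
  have c: "\<Delta> \<one> x \<in> carrier L" "\<Delta> \<one> y \<in> carrier L" "?u \<in> carrier L" "\<Delta> \<one> ?u \<in> carrier L"
    "x \<squnion> y \<in> carrier L"
    using assms by (auto simp: delta_closed one_closed join_closed)
  have "x \<sqsubseteq> \<Delta> \<one> ?u" "y \<sqsubseteq> \<Delta> \<one> ?u"
    using reflect_le_iff [of "\<Delta> \<one> x" ?u] reflect_le_iff [of "\<Delta> \<one> y" ?u] assms c
    by (auto simp: reflect_reflect join_upper1 join_upper2)
  then have "x \<squnion> y \<sqsubseteq> \<Delta> \<one> ?u" using assms c by (intro join_least)
  then show "\<Delta> \<one> (x \<squnion> y) \<sqsubseteq> ?u"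
    using reflect_le_iff [of "x \<squnion> y" "\<Delta> \<one> ?u"] c by (simp add: reflect_reflect)
  show "?u \<sqsubseteq> \<Delta> \<one> (x \<squnion> y)"
    using assms c
    by (intro join_least) (auto simp: reflect_le_iff join_upper1 join_upper2 delta_closed one_closed)
qed (use assms in \<open>auto simp: delta_closed one_closed join_closed\<close>)

lemma prod_closed: "\<lbrakk>x \<in> carrier L; y \<in> carrier L\<rbrakk> \<Longrightarrow> x \<odot> y \<in> carrier L"
  by (simp add: cprod_def join_closed delta_closed one_closed)

lemma le_prod: "\<lbrakk>x \<in> carrier L; y \<in> carrier L\<rbrakk> \<Longrightarrow> y \<sqsubseteq> x \<odot> y"
  by (simp add: cprod_def join_closed delta_closed one_closed join_upper2)

lemma one_prod: "x \<in> carrier L \<Longrightarrow> \<one> \<odot> x = x"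
  using one_greatest [of x]
  by (simp add: cprod_def join_comm [of \<one> x] one_closed cle_def reflect_reflect join_idem)

lemma prod_eq_one_iff:
  assumes "x \<in> carrier L" "y \<in> carrier L"
  shows "x \<odot> y = \<one> \<longleftrightarrow> x \<sqsubseteq> y"
proof
  assume "x \<odot> y = \<one>"
  then show "x \<sqsubseteq> y" using prod_prod [of x y] assms by (simp add: one_prod cle_def)
next
  assume "x \<sqsubseteq> y"
  then show "x \<odot> y = \<one>"
    using assms by (simp add: cprod_def cle_def delta_self delta_join one_closed
        one_greatest [unfolded cle_def])
qed

lemma join_prod_self:
  assumes "x \<in> carrier L" "y \<in> carrier L"
  shows "x \<squnion> x \<odot> y = \<one>"
proof -
  let ?d = "\<Delta> (x \<squnion> y) y"
  have c: "?d \<in> carrier L" "\<Delta> \<one> ?d \<in> carrier L" "x \<squnion> y \<in> carrier L" "x \<squnion> x \<odot> y \<in> carrier L"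
    using assms by (auto simp: delta_closed one_closed join_closed prod_closed)
  have "x \<squnion> x \<odot> y = (x \<squnion> y) \<squnion> \<Delta> \<one> ?d"
    using assms c by (simp add: cprod_def join_assoc join_comm [of "\<Delta> \<one> ?d" y])
  moreover have "?d \<sqsubseteq> x \<squnion> y" using assms c by (simp add: delta_le join_upper2)
  then have "?d \<sqsubseteq> (x \<squnion> y) \<squnion> \<Delta> \<one> ?d"
    using c join_upper1 [of "x \<squnion> y" "\<Delta> \<one> ?d"] le_trans [of ?d "x \<squnion> y"]
    by (simp add: join_closed)
  then have "\<Delta> \<one> ?d \<squnion> ?d \<sqsubseteq> (x \<squnion> y) \<squnion> \<Delta> \<one> ?d"
    using c join_upper2 [of "x \<squnion> y" "\<Delta> \<one> ?d"] by (intro join_least) (auto simp: join_closed)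
  then have "\<one> \<sqsubseteq> (x \<squnion> y) \<squnion> \<Delta> \<one> ?d"
    using c by (simp add: delta_join one_closed one_greatest)
  ultimately show ?thesis using c by (simp add: one_le_iff)
qed

text \<open>
  For \<open>y \<sqsubseteq> z\<close> the element \<open>z\<close> is itself a product with second factor \<open>y\<close>, namely
  \<open>(z \<odot> y) \<odot> y\<close>; exchange then exhibits \<open>x \<odot> z\<close> as a product with second factor \<open>x \<odot> y\<close>.
\<close>
lemma prod_mono:
  assumes "x \<in> carrier L" "y \<in> carrier L" "z \<in> carrier L" "y \<sqsubseteq> z"
  shows "x \<odot> y \<sqsubseteq> x \<odot> z"
proof -
  have "z = (z \<odot> y) \<odot> y" using assms by (simp add: prod_prod cle_def join_comm)
  then have "x \<odot> z = (z \<odot> y) \<odot> (x \<odot> y)"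
    using prod_exchange [of x "z \<odot> y" y] assms by (simp add: prod_closed)
  then show ?thesis using assms by (simp add: le_prod prod_closed)
qed

lemma prod_le_swap:
  "\<lbrakk>x \<in> carrier L; y \<in> carrier L; z \<in> carrier L\<rbrakk> \<Longrightarrow> x \<sqsubseteq> y \<odot> z \<longleftrightarrow> y \<sqsubseteq> x \<odot> z"
  by (simp add: prod_eq_one_iff [symmetric] prod_closed prod_exchange)

lemma prod_trans:
  assumes "x \<in> carrier L" "y \<in> carrier L" "z \<in> carrier L"
  shows "y \<odot> z \<sqsubseteq> (x \<odot> y) \<odot> (x \<odot> z)"
proof -
  have "y \<sqsubseteq> (y \<odot> z) \<odot> z" using assms by (simp add: prod_prod join_upper1)
  then have "x \<odot> y \<sqsubseteq> x \<odot> ((y \<odot> z) \<odot> z)" using assms by (intro prod_mono) (auto simp: prod_closed)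
  then show ?thesis using assms by (simp add: prod_exchange [of x] prod_le_swap prod_closed)
qed

lemma prod_contract:
  assumes "x \<in> carrier L" "y \<in> carrier L"
  shows "x \<odot> (x \<odot> y) = x \<odot> y"
proof (rule le_antisym)
  show "x \<odot> (x \<odot> y) \<sqsubseteq> x \<odot> y"
    using assms by (simp add: prod_eq_one_iff [symmetric] prod_closed prod_prod join_prod_self)
qed (use assms in \<open>auto simp: prod_closed le_prod\<close>)

text \<open>
  Together with \<open>le_prod\<close> this makes \<open>\<odot>\<close> a Hilbert implication, which is what the deduction
  theorem for filters (\<open>filter_adjoin\<close>) rests on.
\<close>
lemma prod_distrib:
  assumes "x \<in> carrier L" "y \<in> carrier L" "z \<in> carrier L"
  shows "x \<odot> (y \<odot> z) \<sqsubseteq> (x \<odot> y) \<odot> (x \<odot> z)"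
proof -
  have "x \<odot> (y \<odot> z) \<sqsubseteq> x \<odot> ((x \<odot> y) \<odot> (x \<odot> z))"
    using assms by (intro prod_mono prod_trans) (auto simp: prod_closed)
  also have "x \<odot> ((x \<odot> y) \<odot> (x \<odot> z)) = (x \<odot> y) \<odot> (x \<odot> z)"
    using assms by (simp add: prod_exchange [of x] prod_contract prod_closed)
  finally show ?thesis .
qed

definition implication_filter :: "'a set \<Rightarrow> bool"
  where "implication_filter F \<longleftrightarrow> F \<subseteq> carrier L \<and> \<one> \<in> F \<and>
    (\<forall>x\<in>F. \<forall>y\<in>carrier L. x \<odot> y \<in> F \<longrightarrow> y \<in> F)"

definition prime_filter :: "'a set \<Rightarrow> bool"
  where "prime_filter F \<longleftrightarrow> implication_filter F \<and>
    (\<forall>x\<in>carrier L. \<forall>y\<in>carrier L. x \<squnion> y \<in> F \<longrightarrow> x \<in> F \<or> y \<in> F)"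

lemma filter_upward:
  "\<lbrakk>implication_filter F; x \<in> F; y \<in> carrier L; x \<sqsubseteq> y\<rbrakk> \<Longrightarrow> y \<in> F"
  unfolding implication_filter_def using prod_eq_one_iff by (metis subsetD)

text \<open>
  This is the filter generated by \<open>F\<close> and \<open>u\<close>; distributivity of the product over itself is
  closure under modus ponens.
\<close>
lemma filter_adjoin:
  assumes "implication_filter F" "u \<in> carrier L"
  shows "implication_filter {x \<in> carrier L. u \<odot> x \<in> F}"
  unfolding implication_filter_def
proof (intro conjI ballI impI)
  show "\<one> \<in> {x \<in> carrier L. u \<odot> x \<in> F}"
    using assms prod_eq_one_iff [of u \<one>] by (simp add: implication_filter_def one_closed one_greatest)
  fix x y
  assume x: "x \<in> {x \<in> carrier L. u \<odot> x \<in> F}" and y: "y \<in> carrier L"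
    and xy: "x \<odot> y \<in> {x \<in> carrier L. u \<odot> x \<in> F}"
  have "(u \<odot> x) \<odot> (u \<odot> y) \<in> F"
    by (rule filter_upward [OF assms(1), of "u \<odot> (x \<odot> y)"])
      (use x y xy assms in \<open>auto simp: prod_closed prod_distrib\<close>)
  moreover have "u \<odot> x \<in> F" using x by simp
  ultimately have "u \<odot> y \<in> F"
    using assms y prod_closed [of u y] unfolding implication_filter_def by blast
  with y show "y \<in> {x \<in> carrier L. u \<odot> x \<in> F}" by simp
qed auto

text \<open>
  A filter that is maximal among those omitting \<open>z\<close> is prime: every \<open>u\<close> outside it satisfies
  \<open>u \<odot> z \<in> F\<close> by maximality, and if two such elements had their join in \<open>F\<close>, case distinction
  would put \<open>z\<close> in \<open>F\<close>.
\<close>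
lemma exists_prime_filter:
  assumes z: "z \<in> carrier L" "z \<noteq> \<one>"
  obtains F where "prime_filter F" "z \<notin> F"
proof -
  let ?A = "{F. implication_filter F \<and> z \<notin> F}"
  have "{\<one>} \<in> ?A"
    using z by (auto simp: implication_filter_def one_closed one_prod)
  then have "?A \<noteq> {}" by blast
  moreover have "\<Union>C \<in> ?A" if C: "C \<noteq> {}" "subset.chain ?A C" for C
  proof -
    have mem: "F \<subseteq> carrier L" "\<one> \<in> F" "z \<notin> F" if "F \<in> C" for F
      using C that by (auto simp: subset_chain_def implication_filter_def)
    have "y \<in> \<Union>C" if x: "x \<in> \<Union>C" and y: "y \<in> carrier L" and xy: "x \<odot> y \<in> \<Union>C" for x y
    proof -
      obtain F G where FG: "F \<in> C" "x \<in> F" "G \<in> C" "x \<odot> y \<in> G" using x xy by blast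
      then have "F \<subseteq> G \<or> G \<subseteq> F" using C by (auto simp: subset_chain_def)
      then obtain H where H: "H \<in> C" "x \<in> H" "x \<odot> y \<in> H" using FG by blast
      then have "implication_filter H" using C by (auto simp: subset_chain_def)
      then have "y \<in> H" using H y unfolding implication_filter_def by blast
      then show ?thesis using H by blast
    qed
    moreover have "\<Union>C \<subseteq> carrier L" "\<one> \<in> \<Union>C" "z \<notin> \<Union>C"
      using C(1) mem by blast+
    ultimately show ?thesis unfolding implication_filter_def mem_Collect_eq by blast
  qed
  ultimately have "\<exists>F\<in>?A. \<forall>G\<in>?A. F \<subseteq> G \<longrightarrow> G = F"
    by (rule subset_Zorn_nonempty)
  then obtain F where F: "F \<in> ?A" and max: "\<And>G. \<lbrakk>G \<in> ?A; F \<subseteq> G\<rbrakk> \<Longrightarrow> G = F"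
    by blast
  have filt: "implication_filter F" and zF: "z \<notin> F" using F by auto
  have mp: "y \<in> F" if "x \<in> F" "x \<odot> y \<in> F" "y \<in> carrier L" for x y
    using filt that unfolding implication_filter_def by blast
  have FL: "x \<in> carrier L" if "x \<in> F" for x
    using filt that unfolding implication_filter_def by blast
  have uz: "u \<odot> z \<in> F" if u: "u \<in> carrier L" "u \<notin> F" for u
  proof (rule ccontr)
    let ?G = "{x \<in> carrier L. u \<odot> x \<in> F}"
    assume "u \<odot> z \<notin> F"
    then have "?G \<in> ?A" using filter_adjoin [OF filt u(1)] by auto
    moreover have "F \<subseteq> ?G"
      using filter_upward [OF filt _ prod_closed [OF u(1)] le_prod [OF u(1)]] FL by blast
    ultimately have "?G = F" using max by blast
    moreover have "u \<in> ?G"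
      using u prod_eq_one_iff [of u u] filt by (simp add: le_refl implication_filter_def)
    ultimately show False using u by blast
  qed
  have "x \<in> F \<or> y \<in> F" if xy: "x \<in> carrier L" "y \<in> carrier L" "x \<squnion> y \<in> F" for x y
  proof (rule ccontr)
    assume *: "\<not> (x \<in> F \<or> y \<in> F)"
    \<comment> \<open>An upper bound of \<open>x\<close> and \<open>y\<close> that leads from \<open>x \<odot> z\<close> and \<open>y \<odot> z\<close> to \<open>z\<close>.\<close>
    let ?e = "(x \<odot> z) \<odot> ((y \<odot> z) \<odot> z)"
    have e: "?e \<in> carrier L" using xy z by (simp add: prod_closed)
    have "x \<sqsubseteq> ?e"
      using xy z by (simp add: prod_le_swap [of x] prod_exchange [of x] prod_closed le_prod)
    moreover have "y \<sqsubseteq> ?e"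
      using xy z le_trans [of y "(y \<odot> z) \<odot> z" ?e]
      by (simp add: prod_prod join_upper1 prod_closed le_prod join_closed)
    ultimately have "?e \<in> F"
      using filter_upward [OF filt xy(3) e] join_least [of x y ?e] xy e by simp
    moreover have "x \<odot> z \<in> F" "y \<odot> z \<in> F" using uz xy * by auto
    moreover have "(y \<odot> z) \<odot> z \<in> carrier L" using xy z by (simp add: prod_closed)
    ultimately have "z \<in> F" using mp z(1) by blast
    with zF show False ..
  qed
  then have "prime_filter F" unfolding prime_filter_def using filt by blast
  then show ?thesis using zF by (rule that)
qed

text \<open>
  The value is \<open>[0, 0]\<close> when only \<open>x\<close> is outside \<open>F\<close>, \<open>[1, 1]\<close> when only its reflection is,
  and the edge when both are in \<open>F\<close>.  They are never both outside a prime filter, since their join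
  is \<open>\<one>\<close>.
\<close>
definition coordinate :: "'a set \<Rightarrow> 'a \<Rightarrow> bool \<times> bool"
  where "coordinate F x = (\<Delta> \<one> x \<notin> F, x \<in> F)"

text \<open>
  Compatibility with \<open>\<Delta>\<close> comes from one fact: for \<open>x \<sqsubseteq> y\<close> the product \<open>y \<odot> x\<close> is the join of
  \<open>x\<close> with the reflection of \<open>\<Delta> y x\<close>, so primeness tells, when \<open>x\<close> is outside \<open>F\<close>, whether that
  reflection is.  Reflecting everything, and exchanging \<open>x\<close> with \<open>\<Delta> y x\<close>, gives four
  instances that determine the coordinate of \<open>\<Delta> y x\<close>.
\<close>
lemma coordinate_hom:
  assumes F: "prime_filter F"
  shows "coordinate F \<in> cubic_hom L (\<I> two_bool)"
proof -
  have filt: "implication_filter F" using F by (simp add: prime_filter_def)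
  have one: "\<one> \<in> F" using filt by (simp add: implication_filter_def)
  have join: "x \<squnion> y \<in> F \<longleftrightarrow> x \<in> F \<or> y \<in> F" if "x \<in> carrier L" "y \<in> carrier L" for x y
    using F that filter_upward [OF filt _ join_closed [OF that] join_upper1 [OF that]]
      filter_upward [OF filt _ join_closed [OF that] join_upper2 [OF that]]
    unfolding prime_filter_def by blast
  have refl_c: "\<Delta> \<one> x \<in> carrier L" if "x \<in> carrier L" for x
    using that by (simp add: delta_closed one_closed)
  have either: "\<Delta> \<one> x \<in> F \<or> x \<in> F" if "x \<in> carrier L" for x
    using join [of "\<Delta> \<one> x" x] one that refl_c by (simp add: delta_join one_closed one_greatest)
  have prod: "x \<odot> y \<in> F \<longleftrightarrow> (x \<in> F \<longrightarrow> y \<in> F)" if "x \<in> carrier L" "y \<in> carrier L" for x y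
  proof -
    have c: "x \<odot> y \<in> carrier L" using that by (rule prod_closed)
    have "x \<in> F \<or> x \<odot> y \<in> F" using join [OF that(1) c] one join_prod_self [OF that] by simp
    moreover have "x \<odot> y \<in> F" if "y \<in> F"
      using filter_upward [OF filt that c] le_prod \<open>x \<in> carrier L\<close> \<open>y \<in> carrier L\<close> by blast
    moreover have "x \<in> F \<Longrightarrow> x \<odot> y \<in> F \<Longrightarrow> y \<in> F"
      using filt that(2) unfolding implication_filter_def by blast
    ultimately show ?thesis by blast
  qed
  have key: "x \<in> F \<or> (\<Delta> \<one> (\<Delta> y x) \<notin> F \<longleftrightarrow> y \<in> F)"
    if "x \<in> carrier L" "y \<in> carrier L" "x \<sqsubseteq> y" for x y
    using prod [of y x] that
    by (auto simp: cprod_def join delta_closed one_closed join_comm cle_def)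
  have delta: "coordinate F (\<Delta> y x) = \<Delta>\<^bsub>\<I> two_bool\<^esub> (coordinate F y) (coordinate F x)"
    if xy: "x \<in> carrier L" "y \<in> carrier L" "x \<sqsubseteq> y" for x y
  proof -
    let ?d = "\<Delta> y x" and ?x = "\<Delta> \<one> x" and ?y = "\<Delta> \<one> y"
    have d: "?d \<in> carrier L" "?d \<sqsubseteq> y" using xy by (auto simp: delta_closed delta_le)
    have xy': "?x \<in> carrier L" "?y \<in> carrier L" "?x \<sqsubseteq> ?y" "\<Delta> \<one> ?d \<in> carrier L" "\<Delta> \<one> ?d \<sqsubseteq> ?y"
      "\<Delta> ?y ?x = \<Delta> \<one> ?d"
      using xy d delta_delta [of x y \<one>, symmetric]
      by (auto simp: refl_c reflect_le_iff one_closed one_greatest)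
    have up: "x \<in> F \<Longrightarrow> y \<in> F" "?x \<in> F \<Longrightarrow> ?y \<in> F" "?d \<in> F \<Longrightarrow> y \<in> F" "\<Delta> \<one> ?d \<in> F \<Longrightarrow> ?y \<in> F"
      using filter_upward [OF filt _ xy(2) xy(3)] filter_upward [OF filt _ xy(2) d(2)]
        filter_upward [OF filt _ xy'(2,3)] filter_upward [OF filt _ xy'(2,5)] by blast+
    have "x \<in> F \<or> (\<Delta> \<one> ?d \<notin> F \<longleftrightarrow> y \<in> F)" using key [OF xy] .
    moreover have "?d \<in> F \<or> (?x \<notin> F \<longleftrightarrow> y \<in> F)"
      using key [OF d(1) xy(2) d(2)] xy by (simp add: delta_involution)
    moreover have "?x \<in> F \<or> (?d \<notin> F \<longleftrightarrow> ?y \<in> F)"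
      using key [OF xy'(1-3)] xy' d by (simp add: reflect_reflect)
    moreover have "\<Delta> \<one> ?d \<in> F \<or> (x \<notin> F \<longleftrightarrow> ?y \<in> F)"
      using key [OF xy'(4) xy'(2) xy'(5)] xy' xy delta_involution [OF xy'(1-3)]
      by (simp add: reflect_reflect)
    ultimately show ?thesis
      using up either [OF xy(1)] either [OF xy(2)] either [OF d(1)]
      by (simp add: coordinate_def) blast
  qed
  have mem: "coordinate F x \<in> carrier (\<I> two_bool)" if "x \<in> carrier L" for x
    using either [OF that] by (auto simp: coordinate_def)
  have homj: "coordinate F (x \<squnion> y) = coordinate F x \<squnion>\<^bsub>\<I> two_bool\<^esub> coordinate F y"
    if "x \<in> carrier L" "y \<in> carrier L" for x y
    using that by (simp add: coordinate_def join reflect_join refl_c)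
  have homd: "coordinate F (\<Delta> x y) = \<Delta>\<^bsub>\<I> two_bool\<^esub> (coordinate F x) (coordinate F y)"
    if "x \<in> carrier L" "y \<in> carrier L" for x y
  proof -
    have "coordinate F (\<Delta> x y) = \<Delta>\<^bsub>\<I> two_bool\<^esub> (coordinate F (x \<squnion> y)) (coordinate F y)"
      using that delta [of y "x \<squnion> y"] delta_total [of x y] by (simp add: join_closed join_upper2)
    then show ?thesis
      using that cubic_implication_algebra.delta_total [OF cubic_interval_two mem mem, of x y]
      by (simp add: homj)
  qed
  have "coordinate F \<one> = \<one>\<^bsub>\<I> two_bool\<^esub>" by (simp add: coordinate_def one delta_self one_closed)
  then show ?thesis
    using mem homj homd by (simp add: cubic_hom_def)
qed

theorem separated_by_coordinates:
  assumes xy: "x \<in> carrier L" "y \<in> carrier L" "x \<noteq> y"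
  obtains h where "h \<in> cubic_hom L (\<I> two_bool)" "h x \<noteq> h y"
proof -
  have *: "\<exists>h \<in> cubic_hom L (\<I> two_bool). h u \<noteq> h w"
    if uw: "u \<in> carrier L" "w \<in> carrier L" "\<not> u \<sqsubseteq> w" for u w
  proof -
    obtain F where F: "prime_filter F" "u \<odot> w \<notin> F"
      using exists_prime_filter [of "u \<odot> w"] uw prod_closed prod_eq_one_iff by metis
    then have filt: "implication_filter F" by (simp add: prime_filter_def)
    have "u \<in> F"
      using F join_prod_self [of u w] uw prod_closed [of u w]
      unfolding prime_filter_def implication_filter_def by metis
    moreover have "w \<notin> F"
      using F filter_upward [OF filt, of w "u \<odot> w"] uw by (auto simp: prod_closed le_prod)
    ultimately have "coordinate F u \<noteq> coordinate F w" by (simp add: coordinate_def)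
    then show ?thesis using coordinate_hom [OF F(1)] by blast
  qed
  have "\<not> x \<sqsubseteq> y \<or> \<not> y \<sqsubseteq> x" using le_antisym xy by blast
  then show ?thesis using * [of x y] * [of y x] xy that by metis
qed

end


section \<open>Boolean algebras and their two-valued homomorphisms\<close>

definition bool_valuations :: "('b, 'm) bool_struct_scheme \<Rightarrow> ('b \<Rightarrow> bool) set"
  where "bool_valuations B = {v. \<not> v \<bottom>\<^bsub>B\<^esub> \<and> v \<top>\<^bsub>B\<^esub> \<and>
    (\<forall>x\<in>carrier B. \<forall>y\<in>carrier B.
      (v (x \<curlywedge>\<^bsub>B\<^esub> y) \<longleftrightarrow> v x \<and> v y) \<and> (v (x \<curlyvee>\<^bsub>B\<^esub> y) \<longleftrightarrow> v x \<or> v y)) \<and>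
    (\<forall>x\<in>carrier B. v (\<ominus>\<^bsub>B\<^esub> x) \<longleftrightarrow> \<not> v x)}"

lemma bool_valuationD:
  assumes "v \<in> bool_valuations B"
  shows "\<not> v \<bottom>\<^bsub>B\<^esub>" and "v \<top>\<^bsub>B\<^esub>"
    and "\<lbrakk>x \<in> carrier B; y \<in> carrier B\<rbrakk> \<Longrightarrow> v (x \<curlywedge>\<^bsub>B\<^esub> y) \<longleftrightarrow> v x \<and> v y"
    and "\<lbrakk>x \<in> carrier B; y \<in> carrier B\<rbrakk> \<Longrightarrow> v (x \<curlyvee>\<^bsub>B\<^esub> y) \<longleftrightarrow> v x \<or> v y"
    and "x \<in> carrier B \<Longrightarrow> v (\<ominus>\<^bsub>B\<^esub> x) \<longleftrightarrow> \<not> v x"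
  using assms unfolding bool_valuations_def by blast+

definition bool_closed :: "('b, 'm) bool_struct_scheme \<Rightarrow> 'b set \<Rightarrow> bool"
  where "bool_closed B S \<longleftrightarrow> \<bottom>\<^bsub>B\<^esub> \<in> S \<and> \<top>\<^bsub>B\<^esub> \<in> S \<and>
    (\<forall>x\<in>S. \<forall>y\<in>S. x \<curlywedge>\<^bsub>B\<^esub> y \<in> S \<and> x \<curlyvee>\<^bsub>B\<^esub> y \<in> S) \<and> (\<forall>x\<in>S. \<ominus>\<^bsub>B\<^esub> x \<in> S)"

lemma bool_closedD:
  assumes "bool_closed B S"
  shows "\<bottom>\<^bsub>B\<^esub> \<in> S" and "\<top>\<^bsub>B\<^esub> \<in> S"
    and "\<lbrakk>x \<in> S; y \<in> S\<rbrakk> \<Longrightarrow> x \<curlywedge>\<^bsub>B\<^esub> y \<in> S"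
    and "\<lbrakk>x \<in> S; y \<in> S\<rbrakk> \<Longrightarrow> x \<curlyvee>\<^bsub>B\<^esub> y \<in> S"
    and "x \<in> S \<Longrightarrow> \<ominus>\<^bsub>B\<^esub> x \<in> S"
  using assms unfolding bool_closed_def by blast+

context boolean_alg
begin

lemma bool_closed_carrier: "bool_closed B (carrier B)"
  by (simp add: bool_closed_def bzero_closed bone_closed bmeet_closed bjoin_closed bcompl_closed)

lemma bmeet_idem:
  assumes "x \<in> carrier B"
  shows "x \<curlywedge> x = x"
proof -
  have "x = x \<curlywedge> (x \<curlyvee> \<ominus> x)" using assms by (simp add: bjoin_bcompl bmeet_bone)
  also have "\<dots> = x \<curlywedge> x"
    using assms by (simp add: bmeet_bjoin_distrib bcompl_closed bmeet_bcompl bjoin_bzero bmeet_closed)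
  finally show ?thesis ..
qed

lemma bjoin_idem:
  assumes "x \<in> carrier B"
  shows "x \<curlyvee> x = x"
proof -
  have "x = x \<curlyvee> (x \<curlywedge> \<ominus> x)" using assms by (simp add: bmeet_bcompl bjoin_bzero)
  also have "\<dots> = x \<curlyvee> x"
    using assms by (simp add: bjoin_bmeet_distrib bcompl_closed bjoin_bcompl bmeet_bone bjoin_closed)
  finally show ?thesis ..
qed

lemma bmeet_bzero:
  assumes "x \<in> carrier B"
  shows "x \<curlywedge> \<bottom> = \<bottom>"
  using bmeet_assoc [of x x "\<ominus> x"] assms by (simp add: bcompl_closed bmeet_bcompl bmeet_idem)

text \<open>
  The valuation separating two elements is \<open>\<lambda>b. y \<le> b\<close> for an element \<open>y \<noteq> \<bottom>\<close> that lies below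
  \<open>b\<close> or is disjoint from \<open>b\<close>, for every \<open>b\<close>.  As the elements decided by \<open>y\<close> form a subalgebra,
  such a \<open>y\<close> below a given nonzero element is found by treating finitely many generators in turn.
\<close>
definition decides :: "'b \<Rightarrow> 'b \<Rightarrow> bool"
  where "decides y b \<longleftrightarrow> y \<curlywedge> b = y \<or> y \<curlywedge> b = \<bottom>"

lemma decides_compl:
  assumes "y \<in> carrier B" "b \<in> carrier B" 
  shows "y \<curlywedge> b = y \<Longrightarrow> y \<curlywedge> \<ominus> b = \<bottom>" and "y \<curlywedge> b = \<bottom> \<Longrightarrow> y \<curlywedge> \<ominus> b = y"
proof -
  assume "y \<curlywedge> b = y"
  then show "y \<curlywedge> \<ominus> b = \<bottom>"
    using bmeet_assoc [of y b "\<ominus> b"] assms by (simp add: bcompl_closed bmeet_bcompl bmeet_bzero)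
next
  assume "y \<curlywedge> b = \<bottom>"
  moreover have "y = (y \<curlywedge> b) \<curlyvee> (y \<curlywedge> \<ominus> b)"
    using bmeet_bjoin_distrib [of y b "\<ominus> b"] assms
    by (simp add: bcompl_closed bjoin_bcompl bmeet_bone)
  ultimately show "y \<curlywedge> \<ominus> b = y"
    using assms bjoin_comm [of \<bottom>] by (simp add: bcompl_closed bjoin_bzero bmeet_closed bzero_closed)
qed

lemma bool_closed_decided:
  assumes "y \<in> carrier B"
  shows "bool_closed B {b \<in> carrier B. decides y b}"
  using assms
  by (auto simp: bool_closed_def decides_def bzero_closed bone_closed bmeet_closed bjoin_closed
      bcompl_closed bmeet_bzero bmeet_bone bmeet_assoc [symmetric] bmeet_bjoin_distrib
      bjoin_idem bjoin_bzero decides_compl bjoin_comm [of \<bottom>] bmeet_comm [of \<bottom>])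

lemma decided_valuation:
  assumes "y \<in> carrier B" "y \<noteq> \<bottom>" "\<And>b. b \<in> carrier B \<Longrightarrow> decides y b"
  shows "(\<lambda>b. y \<curlywedge> b = y) \<in> bool_valuations B"
proof -
  have *: "y \<curlywedge> b = y \<or> y \<curlywedge> b = \<bottom>" if "b \<in> carrier B" for b
    using assms(3) [OF that] by (simp add: decides_def)
  have zero: "\<bottom> \<noteq> y" using assms(2) by blast
  have m: "(y \<curlywedge> (b \<curlywedge> c) = y) = (y \<curlywedge> b = y \<and> y \<curlywedge> c = y)"
    if "b \<in> carrier B" "c \<in> carrier B" for b c
    using * [OF that(1)] * [OF that(2)] bmeet_assoc [of y b c] bmeet_comm [of \<bottom> c] that assms(1) zero
    by (auto simp: bmeet_bzero bzero_closed)
  have j: "(y \<curlywedge> (b \<curlyvee> c) = y) = (y \<curlywedge> b = y \<or> y \<curlywedge> c = y)"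
    if "b \<in> carrier B" "c \<in> carrier B" for b c
    using * [OF that(1)] * [OF that(2)] bjoin_comm [of \<bottom> y] that assms(1) zero
    by (auto simp: bmeet_bjoin_distrib bjoin_idem bjoin_bzero bzero_closed)
  have n: "(y \<curlywedge> \<ominus> b = y) = (y \<curlywedge> b \<noteq> y)" if "b \<in> carrier B" for b
    using * [OF that] decides_compl [OF assms(1) that] zero by auto
  show ?thesis
    using assms zero by (simp add: bool_valuations_def m j n bmeet_bzero bmeet_bone)
qed

lemma decide_finite:
  assumes "finite G" "G \<subseteq> carrier B" "z \<in> carrier B" "z \<noteq> \<bottom>"
  shows "\<exists>y\<in>carrier B. y \<noteq> \<bottom> \<and> y \<curlywedge> z = y \<and> (\<forall>g\<in>G. decides y g)"
  using assms
proof (induction G)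
  case empty
  then show ?case using bmeet_idem by blast
next
  case (insert g G)
  then obtain y where y: "y \<in> carrier B" "y \<noteq> \<bottom>" "y \<curlywedge> z = y" "\<forall>g\<in>G. decides y g"
    by auto
  have g: "g \<in> carrier B" using insert by simp
  show ?case
  proof (cases "y \<curlywedge> g = \<bottom>")
    case True
    then show ?thesis using y by (auto simp: decides_def)
  next
    case False
    let ?y = "y \<curlywedge> g"
    have yh: "?y \<curlywedge> h = (y \<curlywedge> h) \<curlywedge> g" if "h \<in> carrier B" for h
      using y g that by (simp add: bmeet_assoc bmeet_comm [of g h])
    have "decides ?y h" if "h \<in> G" for h
    proof -
      have "h \<in> carrier B" using that insert by auto
      then show ?thesis
        using y(4) that yh [of h] g bmeet_comm [of \<bottom> g]
        by (auto simp: decides_def bmeet_bzero bzero_closed)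
    qed
    moreover have "decides ?y g" "?y \<curlywedge> z = ?y"
      using y g insert yh [of z] by (simp_all add: decides_def bmeet_assoc bmeet_idem)
    ultimately show ?thesis using False y g bmeet_closed by blast
  qed
qed

theorem separated_by_valuations:
  assumes G: "finite G" "G \<subseteq> carrier B"
    and gen: "\<And>S. \<lbrakk>S \<subseteq> carrier B; G \<subseteq> S; bool_closed B S\<rbrakk> \<Longrightarrow> S = carrier B"
    and xy: "x \<in> carrier B" "y \<in> carrier B" "x \<noteq> y"
  obtains v where "v \<in> bool_valuations B" "v x \<noteq> v y"
proof -
  have *: "\<exists>v\<in>bool_valuations B. v a \<and> \<not> v b"
    if ab: "a \<in> carrier B" "b \<in> carrier B" "a \<curlywedge> \<ominus> b \<noteq> \<bottom>" for a b
  proof -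
    let ?z = "a \<curlywedge> \<ominus> b"
    have z: "?z \<in> carrier B" using ab by (simp add: bmeet_closed bcompl_closed)
    obtain w where w: "w \<in> carrier B" "w \<noteq> \<bottom>" "w \<curlywedge> ?z = w" "\<forall>g\<in>G. decides w g"
      using decide_finite [OF G z ab(3)] by blast
    have "{b \<in> carrier B. decides w b} = carrier B"
      using w G by (intro gen) (auto simp: bool_closed_decided)
    then have "decides w b" if "b \<in> carrier B" for b using that by blast
    then have v: "(\<lambda>b. w \<curlywedge> b = w) \<in> bool_valuations B"
      using w by (intro decided_valuation)
    then show ?thesis
      using w bool_valuationD(3) [OF v ab(1) bcompl_closed [OF ab(2)]] bool_valuationD(5) [OF v ab(2)]
      by (intro bexI [OF _ v]) auto
  qed
  have split: "a = a \<curlywedge> b" if "a \<in> carrier B" "b \<in> carrier B" "a \<curlywedge> \<ominus> b = \<bottom>" for a b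
    using bmeet_bjoin_distrib [of a b "\<ominus> b"] that
    by (simp add: bcompl_closed bjoin_bcompl bmeet_bone bjoin_bzero bmeet_closed)
  have "x \<curlywedge> \<ominus> y \<noteq> \<bottom> \<or> y \<curlywedge> \<ominus> x \<noteq> \<bottom>"
    using split [of x y] split [of y x] bmeet_comm [of x y] xy by metis
  then show ?thesis
    using * [of x y] * [of y x] xy that by metis
qed

end


section \<open>Quotients of Boolean algebras\<close>

lemma bool_quotient_simps:
  assumes "bool_congruence B \<theta>"
  shows "carrier (bool_quotient B \<theta>) = carrier B // \<theta>"
    and "\<bottom>\<^bsub>bool_quotient B \<theta>\<^esub> = \<theta> `` {\<bottom>\<^bsub>B\<^esub>}"
    and "\<top>\<^bsub>bool_quotient B \<theta>\<^esub> = \<theta> `` {\<top>\<^bsub>B\<^esub>}"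
    and "\<lbrakk>x \<in> carrier B; y \<in> carrier B\<rbrakk>
      \<Longrightarrow> \<theta> `` {x} \<curlywedge>\<^bsub>bool_quotient B \<theta>\<^esub> \<theta> `` {y} = \<theta> `` {x \<curlywedge>\<^bsub>B\<^esub> y}"
    and "\<lbrakk>x \<in> carrier B; y \<in> carrier B\<rbrakk>
      \<Longrightarrow> \<theta> `` {x} \<curlyvee>\<^bsub>bool_quotient B \<theta>\<^esub> \<theta> `` {y} = \<theta> `` {x \<curlyvee>\<^bsub>B\<^esub> y}"
    and "x \<in> carrier B \<Longrightarrow> \<ominus>\<^bsub>bool_quotient B \<theta>\<^esub> (\<theta> `` {x}) = \<theta> `` {\<ominus>\<^bsub>B\<^esub> x}"
proof -
  have eq: "equiv (carrier B) \<theta>"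
    using assms by (simp add: bool_congruence_def)
  show "carrier (bool_quotient B \<theta>) = carrier B // \<theta>"
    and "\<bottom>\<^bsub>bool_quotient B \<theta>\<^esub> = \<theta> `` {\<bottom>\<^bsub>B\<^esub>}"
    and "\<top>\<^bsub>bool_quotient B \<theta>\<^esub> = \<theta> `` {\<top>\<^bsub>B\<^esub>}"
    by (simp_all add: bool_quotient_def)
  have m: "congruent2 \<theta> \<theta> (\<lambda>x y. \<theta> `` {x \<curlywedge>\<^bsub>B\<^esub> y})"
    and j: "congruent2 \<theta> \<theta> (\<lambda>x y. \<theta> `` {x \<curlyvee>\<^bsub>B\<^esub> y})"
    and n: "congruent \<theta> (\<lambda>x. \<theta> `` {\<ominus>\<^bsub>B\<^esub> x})"
    using assms unfolding bool_congruence_def congruent2_def congruent_def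
    by (auto simp: case_prod_unfold intro!: equiv_class_eq [OF eq])
  show "\<theta> `` {x} \<curlywedge>\<^bsub>bool_quotient B \<theta>\<^esub> \<theta> `` {y} = \<theta> `` {x \<curlywedge>\<^bsub>B\<^esub> y}"
    "\<theta> `` {x} \<curlyvee>\<^bsub>bool_quotient B \<theta>\<^esub> \<theta> `` {y} = \<theta> `` {x \<curlyvee>\<^bsub>B\<^esub> y}"
    if "x \<in> carrier B" "y \<in> carrier B" for x y
    using UN_equiv_class2 [OF eq eq m that] UN_equiv_class2 [OF eq eq j that]
    by (simp_all add: bool_quotient_def)
  show "\<ominus>\<^bsub>bool_quotient B \<theta>\<^esub> (\<theta> `` {x}) = \<theta> `` {\<ominus>\<^bsub>B\<^esub> x}" if "x \<in> carrier B"
    using UN_equiv_class [OF eq n that] by (simp add: bool_quotient_def)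
qed

text \<open>
  The relation is a parameter so that the axioms can be read in \<open>B\<close> itself (with equality) and
  modulo a congruence, where they are inherited by intersections of congruences.
\<close>
definition bool_laws :: "('b, 'm) bool_struct_scheme \<Rightarrow> ('b \<Rightarrow> 'b \<Rightarrow> bool) \<Rightarrow> bool"
  where "bool_laws B R \<longleftrightarrow> (\<forall>x\<in>carrier B. \<forall>y\<in>carrier B. \<forall>z\<in>carrier B.
    R ((x \<curlywedge>\<^bsub>B\<^esub> y) \<curlywedge>\<^bsub>B\<^esub> z) (x \<curlywedge>\<^bsub>B\<^esub> (y \<curlywedge>\<^bsub>B\<^esub> z)) \<and> R ((x \<curlyvee>\<^bsub>B\<^esub> y) \<curlyvee>\<^bsub>B\<^esub> z) (x \<curlyvee>\<^bsub>B\<^esub> (y \<curlyvee>\<^bsub>B\<^esub> z)) \<and>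
    R (x \<curlywedge>\<^bsub>B\<^esub> y) (y \<curlywedge>\<^bsub>B\<^esub> x) \<and> R (x \<curlyvee>\<^bsub>B\<^esub> y) (y \<curlyvee>\<^bsub>B\<^esub> x) \<and>
    R (x \<curlywedge>\<^bsub>B\<^esub> (y \<curlyvee>\<^bsub>B\<^esub> z)) ((x \<curlywedge>\<^bsub>B\<^esub> y) \<curlyvee>\<^bsub>B\<^esub> (x \<curlywedge>\<^bsub>B\<^esub> z)) \<and>
    R (x \<curlyvee>\<^bsub>B\<^esub> (y \<curlywedge>\<^bsub>B\<^esub> z)) ((x \<curlyvee>\<^bsub>B\<^esub> y) \<curlywedge>\<^bsub>B\<^esub> (x \<curlyvee>\<^bsub>B\<^esub> z)) \<and>
    R (x \<curlywedge>\<^bsub>B\<^esub> \<top>\<^bsub>B\<^esub>) x \<and> R (x \<curlyvee>\<^bsub>B\<^esub> \<bottom>\<^bsub>B\<^esub>) x \<and> R (x \<curlywedge>\<^bsub>B\<^esub> \<ominus>\<^bsub>B\<^esub> x) \<bottom>\<^bsub>B\<^esub> \<and> R (x \<curlyvee>\<^bsub>B\<^esub> \<ominus>\<^bsub>B\<^esub> x) \<top>\<^bsub>B\<^esub>)"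

lemma (in boolean_alg) bool_laws_eq: "bool_laws B (=)"
  unfolding bool_laws_def
  by (intro ballI conjI bmeet_assoc bjoin_assoc bmeet_bjoin_distrib bjoin_bmeet_distrib
      bmeet_bone bjoin_bzero bmeet_bcompl bjoin_bcompl; (rule bmeet_comm bjoin_comm)?; assumption)

lemma boolean_alg_iff: "boolean_alg B \<longleftrightarrow> bool_closed B (carrier B) \<and> bool_laws B (=)"
proof
  show "bool_closed B (carrier B) \<and> bool_laws B (=)" if "boolean_alg B"
    using that by (simp add: boolean_alg.bool_closed_carrier boolean_alg.bool_laws_eq)
  show "boolean_alg B" if "bool_closed B (carrier B) \<and> bool_laws B (=)"
    using that unfolding bool_closed_def bool_laws_def by unfold_locales blast+
qed

lemma boolean_alg_quotient_iff:
  assumes closed: "bool_closed B (carrier B)" and cong: "bool_congruence B \<theta>"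
  shows "boolean_alg (bool_quotient B \<theta>) \<longleftrightarrow> bool_laws B (\<lambda>x y. (x, y) \<in> \<theta>)"
proof -
  have eq: "equiv (carrier B) \<theta>"
    using cong by (simp add: bool_congruence_def)
  note Q = bool_quotient_simps [OF cong]
  have c: "\<bottom>\<^bsub>B\<^esub> \<in> carrier B" "\<top>\<^bsub>B\<^esub> \<in> carrier B"
    "\<And>x y. \<lbrakk>x \<in> carrier B; y \<in> carrier B\<rbrakk> \<Longrightarrow> x \<curlywedge>\<^bsub>B\<^esub> y \<in> carrier B"
    "\<And>x y. \<lbrakk>x \<in> carrier B; y \<in> carrier B\<rbrakk> \<Longrightarrow> x \<curlyvee>\<^bsub>B\<^esub> y \<in> carrier B"
    "\<And>x. x \<in> carrier B \<Longrightarrow> \<ominus>\<^bsub>B\<^esub> x \<in> carrier B"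
    using closed by (auto simp: bool_closed_def)
  have q: "(\<forall>P\<in>carrier (bool_quotient B \<theta>). \<Phi> P) \<longleftrightarrow> (\<forall>x\<in>carrier B. \<Phi> (\<theta> `` {x}))" for \<Phi>
    by (auto simp: Q(1) intro: quotientI elim!: quotientE)
  have "bool_closed (bool_quotient B \<theta>) (carrier (bool_quotient B \<theta>))"
    unfolding bool_closed_def q by (simp add: Q c quotientI)
  moreover have "bool_laws (bool_quotient B \<theta>) (=) \<longleftrightarrow> bool_laws B (\<lambda>x y. (x, y) \<in> \<theta>)"
    unfolding bool_laws_def q by (intro ball_cong refl) (simp add: Q c eq_equiv_class_iff [OF eq])
  ultimately show ?thesis by (simp add: boolean_alg_iff)
qed

lemma bool_congruenceD:
  assumes "bool_congruence B \<theta>"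
  shows "equiv (carrier B) \<theta>" and "x \<in> carrier B \<Longrightarrow> (x, x) \<in> \<theta>" and "\<theta> \<subseteq> carrier B \<times> carrier B"
    and "(x, y) \<in> \<theta> \<Longrightarrow> (y, x) \<in> \<theta>" and "\<lbrakk>(x, y) \<in> \<theta>; (y, z) \<in> \<theta>\<rbrakk> \<Longrightarrow> (x, z) \<in> \<theta>"
    and "\<lbrakk>(x, x') \<in> \<theta>; (y, y') \<in> \<theta>\<rbrakk> \<Longrightarrow> (x \<curlywedge>\<^bsub>B\<^esub> y, x' \<curlywedge>\<^bsub>B\<^esub> y') \<in> \<theta>"
    and "\<lbrakk>(x, x') \<in> \<theta>; (y, y') \<in> \<theta>\<rbrakk> \<Longrightarrow> (x \<curlyvee>\<^bsub>B\<^esub> y, x' \<curlyvee>\<^bsub>B\<^esub> y') \<in> \<theta>"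
    and "(x, x') \<in> \<theta> \<Longrightarrow> (\<ominus>\<^bsub>B\<^esub> x, \<ominus>\<^bsub>B\<^esub> x') \<in> \<theta>"
proof -
  show e: "equiv (carrier B) \<theta>" using assms by (simp add: bool_congruence_def)
  then show "x \<in> carrier B \<Longrightarrow> (x, x) \<in> \<theta>" "\<theta> \<subseteq> carrier B \<times> carrier B"
    "(x, y) \<in> \<theta> \<Longrightarrow> (y, x) \<in> \<theta>" "\<lbrakk>(x, y) \<in> \<theta>; (y, z) \<in> \<theta>\<rbrakk> \<Longrightarrow> (x, z) \<in> \<theta>"
    by (auto elim!: equivE dest: refl_onD symD transD)
qed (use assms in \<open>unfold bool_congruence_def, fast\<close>)+

lemma bool_congruence_Inter:
  assumes "\<Theta> \<noteq> {}" "\<And>\<theta>. \<theta> \<in> \<Theta> \<Longrightarrow> bool_congruence B \<theta>"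
  shows "bool_congruence B (\<Inter>\<Theta>)"
proof -
  note D = bool_congruenceD [OF assms(2)]
  have "equiv (carrier B) (\<Inter>\<Theta>)"
  proof (rule equivI)
    show "\<Inter>\<Theta> \<subseteq> carrier B \<times> carrier B" using assms(1) D(3) by blast
    show "refl_on (carrier B) (\<Inter>\<Theta>)" using D(2) by (simp add: refl_on_def)
    show "sym (\<Inter>\<Theta>)" using D(4) by (intro symI) blast
    show "trans (\<Inter>\<Theta>)" using D(5) by (intro transI) blast
  qed
  then show ?thesis using D(6-8) unfolding bool_congruence_def by blast
qed

lemma bool_congruence_total:
  "bool_closed B (carrier B) \<Longrightarrow> bool_congruence B (carrier B \<times> carrier B)"
  by (auto simp: bool_congruence_def bool_closed_def equiv_def refl_on_def sym_def trans_def)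

lemma bool_congruence_kernel:
  assumes "bool_closed B (carrier B)" "v \<in> bool_valuations B"
  shows "bool_congruence B {(x, y). x \<in> carrier B \<and> y \<in> carrier B \<and> (v x \<longleftrightarrow> v y)}"
  using assms by (auto simp: bool_congruence_def bool_closed_def equiv_def refl_on_def sym_def trans_def
      bool_valuationD [OF assms(2)])

lemma valuation_of_quotient:
  assumes closed: "bool_closed B (carrier B)" and cong: "bool_congruence B \<theta>"
    and v: "v \<in> bool_valuations (bool_quotient B \<theta>)"
  shows "(\<lambda>x. v (\<theta> `` {x})) \<in> bool_valuations B"
proof -
  have "\<theta> `` {x} \<in> carrier (bool_quotient B \<theta>)" if "x \<in> carrier B" for x
    using that by (auto simp: bool_quotient_simps [OF cong] intro: quotientI)
  then show ?thesis
    using closed bool_valuationD [OF v]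
    by (simp add: bool_valuations_def bool_closed_def bool_quotient_simps(2-6) [OF cong, symmetric])
qed

lemma quotient_valuation:
  assumes closed: "bool_closed B (carrier B)" and cong: "bool_congruence B \<theta>"
    and v: "v \<in> bool_valuations B"
    and ker: "\<And>x y. (x, y) \<in> \<theta> \<Longrightarrow> v x \<longleftrightarrow> v y"
  obtains w where "w \<in> bool_valuations (bool_quotient B \<theta>)"
    "\<And>x. x \<in> carrier B \<Longrightarrow> w (\<theta> `` {x}) \<longleftrightarrow> v x"
proof -
  let ?w = "\<lambda>P. \<exists>x\<in>P. v x"
  note Q = bool_quotient_simps [OF cong]
  have w: "?w (\<theta> `` {x}) \<longleftrightarrow> v x" if "x \<in> carrier B" for x
    using ker [of x] bool_congruenceD(2) [OF cong that] by blast
  have q: "(\<forall>P\<in>carrier (bool_quotient B \<theta>). \<Phi> P) \<longleftrightarrow> (\<forall>x\<in>carrier B. \<Phi> (\<theta> `` {x}))" for \<Phi>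
    by (auto simp: Q(1) intro: quotientI elim!: quotientE)
  have "?w \<in> bool_valuations (bool_quotient B \<theta>)"
    using closed unfolding bool_valuations_def q mem_Collect_eq
    by (simp add: Q w bool_closed_def bool_valuationD [OF v] del: Image_singleton_iff bex_simps)
  with w show ?thesis by (intro that) auto
qed


section \<open>The Boolean algebras \<open>\<B> k\<close>\<close>

lemma bool_terms_simps [simp]:
  "carrier (bool_terms G) = {p. bgens p \<subseteq> G}"
  "\<bottom>\<^bsub>bool_terms G\<^esub> = BZero" "\<top>\<^bsub>bool_terms G\<^esub> = BOne"
  "p \<curlywedge>\<^bsub>bool_terms G\<^esub> q = BMeet p q" "p \<curlyvee>\<^bsub>bool_terms G\<^esub> q = BJoin p q"
  "\<ominus>\<^bsub>bool_terms G\<^esub> p = BCompl p"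
  by (simp_all add: bool_terms_def)

lemma bool_closed_terms: "bool_closed (bool_terms G) {p. bgens p \<subseteq> G}"
  by (simp add: bool_closed_def)

lemma free_bool_congruence: "bool_congruence (bool_terms G) (free_bool_congruence G)"
  and free_bool_laws: "bool_laws (bool_terms G) (\<lambda>x y. (x, y) \<in> free_bool_congruence G)"
proof -
  let ?T = "bool_terms G"
  have F: "free_bool_congruence G
    = \<Inter> {\<theta>. bool_congruence ?T \<theta> \<and> bool_laws ?T (\<lambda>x y. (x, y) \<in> \<theta>)}"
    unfolding free_bool_congruence_def
    by (rule arg_cong [of _ _ Inter]) (auto simp: boolean_alg_quotient_iff bool_closed_terms)
  have "bool_congruence ?T (carrier ?T \<times> carrier ?T)"
    by (rule bool_congruence_total) (simp add: bool_closed_terms)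
  moreover have "bool_laws ?T (\<lambda>x y. (x, y) \<in> carrier ?T \<times> carrier ?T)"
    by (auto simp: bool_laws_def)
  ultimately show "bool_congruence ?T (free_bool_congruence G)"
    unfolding F by (intro bool_congruence_Inter) auto
  show "bool_laws ?T (\<lambda>x y. (x, y) \<in> free_bool_congruence G)"
    unfolding F bool_laws_def by blast
qed

lemma boolean_alg_free_bool: "boolean_alg (free_bool G)"
  using free_bool_laws
  by (simp add: free_bool_def boolean_alg_quotient_iff bool_closed_terms free_bool_congruence)

primrec bool_eval :: "('g \<Rightarrow> bool) \<Rightarrow> 'g bool_term \<Rightarrow> bool"
  where
    "bool_eval f (BGen g) = f g"
  | "bool_eval f BZero = False"
  | "bool_eval f BOne = True"
  | "bool_eval f (BMeet p q) = (bool_eval f p \<and> bool_eval f q)"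
  | "bool_eval f (BJoin p q) = (bool_eval f p \<or> bool_eval f q)"
  | "bool_eval f (BCompl p) = (\<not> bool_eval f p)"

lemma free_bool_valuation:
  obtains v where "v \<in> bool_valuations (free_bool G)" "\<And>g. g \<in> G \<Longrightarrow> v (free_bool_gen G g) \<longleftrightarrow> f g"
proof -
  let ?T = "bool_terms G"
  let ?K = "{(p, q). p \<in> carrier ?T \<and> q \<in> carrier ?T \<and> (bool_eval f p \<longleftrightarrow> bool_eval f q)}"
  have e: "bool_eval f \<in> bool_valuations ?T" by (simp add: bool_valuations_def)
  have cong: "bool_congruence ?T ?K"
    by (rule bool_congruence_kernel [OF _ e]) (simp add: bool_closed_terms)
  moreover have "boolean_alg (bool_quotient ?T ?K)"
    using cong by (subst boolean_alg_quotient_iff) (auto simp: bool_closed_terms bool_laws_def)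
  ultimately have "free_bool_congruence G \<subseteq> ?K"
    unfolding free_bool_congruence_def by blast
  then have ker: "bool_eval f p \<longleftrightarrow> bool_eval f q" if "(p, q) \<in> free_bool_congruence G" for p q
    using that by blast
  obtain w where "w \<in> bool_valuations (free_bool G)"
    "\<And>x. x \<in> carrier ?T \<Longrightarrow> w (free_bool_congruence G `` {x}) \<longleftrightarrow> bool_eval f x"
    using quotient_valuation [OF _ free_bool_congruence e ker] unfolding free_bool_def
    by (auto simp: bool_closed_terms)
  then show ?thesis by (intro that [of w]) (auto simp: free_bool_gen_def)
qed

lemma free_bool_gen_closed: "g \<in> G \<Longrightarrow> free_bool_gen G g \<in> carrier (free_bool G)"
  by (auto simp: free_bool_gen_def free_bool_def bool_quotient_def intro: quotientI)

lemma bool_closed_preimage: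
  assumes cong: "bool_congruence B \<theta>" and S: "bool_closed (bool_quotient B \<theta>) S"
  and closed: "bool_closed B (carrier B)"
  shows "bool_closed B {x \<in> carrier B. \<theta> `` {x} \<in> S}"
  using S closed by (auto simp: bool_closed_def bool_quotient_simps(2-6) [OF cong, symmetric])

lemma free_bool_generated:
  assumes S: "S \<subseteq> carrier (free_bool G)" "free_bool_gen G ` G \<subseteq> S" "bool_closed (free_bool G) S"
  shows "S = carrier (free_bool G)"
proof -
  have "bool_closed (bool_terms G)
    {p \<in> carrier (bool_terms G). free_bool_congruence G `` {p} \<in> S}" (is "bool_closed _ ?S")
    using S(3) unfolding free_bool_def
    by (intro bool_closed_preimage [OF free_bool_congruence]) (auto simp: bool_closed_terms)
  moreover have "BGen g \<in> ?S" if "g \<in> G" for g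
    using that S(2) by (auto simp: free_bool_gen_def)
  ultimately have "p \<in> ?S" if "bgens p \<subseteq> G" for p
    using that by (induction p) (auto simp: bool_closed_def)
  then have "carrier (free_bool G) \<subseteq> S"
    by (auto simp: free_bool_def bool_quotient_def elim!: quotientE)
  with S(1) show ?thesis by blast
qed

definition st_relations_hold :: "nat \<Rightarrow> (nat \<Rightarrow> bool) \<Rightarrow> (nat \<Rightarrow> bool) \<Rightarrow> bool"
  where "st_relations_hold k s t \<longleftrightarrow> \<not> s 0 \<and> (\<forall>i\<le>k. s i \<longrightarrow> t i) \<and>
    (\<forall>i<k. t 0 \<longrightarrow> (\<exists>j\<in>{1..i}. s j) \<or> t (i + 1)) \<and> (t 0 \<longrightarrow> (\<exists>j\<in>{1..k}. s j))"

lemma bjoin_upto_closed: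
  "\<lbrakk>boolean_alg B; \<And>j. j \<le> n \<Longrightarrow> f j \<in> carrier B\<rbrakk> \<Longrightarrow> bjoin_upto B f n \<in> carrier B"
  by (induction n) (auto simp: boolean_alg.bzero_closed boolean_alg.bjoin_closed)

lemma valuation_bjoin_upto:
  assumes "boolean_alg B" "v \<in> bool_valuations B" "\<And>j. j \<le> n \<Longrightarrow> f j \<in> carrier B"
  shows "v (bjoin_upto B f n) \<longleftrightarrow> (\<exists>j\<in>{1..n}. v (f j))"
  using assms(3)
proof (induction n)
  case (Suc n)
  then have "v (bjoin_upto B f (Suc n)) \<longleftrightarrow> (\<exists>j\<in>{1..n}. v (f j)) \<or> v (f (Suc n))"
    using bjoin_upto_closed [OF assms(1), of n f] bool_valuationD(4) [OF assms(2)] by simp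
  then show ?case by (simp add: atLeastAtMostSuc_conv disj_commute)
qed (simp add: bool_valuationD(1) [OF assms(2)])

text \<open>
  Read in one direction this lets an assignment that satisfies the relations descend to \<open>\<B> k\<close>;
  read in the other it says that all valuations of \<open>\<B> k\<close> satisfy them.
\<close>
lemma st_relations_closed:
  "st_relations k \<subseteq> carrier (free_bool (st_gens k)) \<times> carrier (free_bool (st_gens k))"
  and st_relations_valuation:
  "v \<in> bool_valuations (free_bool (st_gens k)) \<Longrightarrow> (\<forall>(x, y) \<in> st_relations k. v x = v y) \<longleftrightarrow>
    st_relations_hold k (\<lambda>i. v (free_bool_gen (st_gens k) (SGen i)))
      (\<lambda>i. v (free_bool_gen (st_gens k) (TGen i)))"
proof -
  let ?F = "free_bool (st_gens k)"
  let ?s = "\<lambda>i. free_bool_gen (st_gens k) (SGen i)" and ?t = "\<lambda>i. free_bool_gen (st_gens k) (TGen i)"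
  interpret F: boolean_alg ?F by (rule boolean_alg_free_bool)
  have s: "?s i \<in> carrier ?F" and t: "?t i \<in> carrier ?F" if "i \<le> k" for i
    using that by (auto intro!: free_bool_gen_closed simp: st_gens_def)
  have b: "bjoin_upto ?F ?s i \<in> carrier ?F" if "i \<le> k" for i
    using that s by (intro bjoin_upto_closed F.boolean_alg_axioms) auto
  have bt: "bjoin_upto ?F ?s i \<curlyvee>\<^bsub>?F\<^esub> ?t (Suc i) \<in> carrier ?F" if "i < k" for i
    using that by (intro F.bjoin_closed b t) simp_all
  show "st_relations k \<subseteq> carrier ?F \<times> carrier ?F"
    using s t b bt by (auto simp: st_relations_def Let_def F.bzero_closed F.bmeet_closed)
  assume v: "v \<in> bool_valuations ?F"
  note D = bool_valuationD [OF v]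
  have vb: "v (bjoin_upto ?F ?s i) \<longleftrightarrow> (\<exists>j\<in>{1..i}. v (?s j))" if "i \<le> k" for i
    using that s by (intro valuation_bjoin_upto [OF F.boolean_alg_axioms v]) auto
  have "(\<forall>(x, y) \<in> st_relations k. v x = v y) \<longleftrightarrow> v (?s 0) = v \<bottom>\<^bsub>?F\<^esub> \<and>
    (\<forall>i\<le>k. v (?s i \<curlywedge>\<^bsub>?F\<^esub> ?t i) = v (?s i)) \<and>
    (\<forall>i<k. v (?t 0 \<curlywedge>\<^bsub>?F\<^esub> (bjoin_upto ?F ?s i \<curlyvee>\<^bsub>?F\<^esub> ?t (i + 1))) = v (?t 0)) \<and>
    v (?t 0 \<curlywedge>\<^bsub>?F\<^esub> bjoin_upto ?F ?s k) = v (?t 0)"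
    unfolding st_relations_def Let_def by blast
  also have "\<dots> \<longleftrightarrow> st_relations_hold k (\<lambda>i. v (?s i)) (\<lambda>i. v (?t i))"
    using s t b bt by (auto simp: st_relations_hold_def D vb)
  finally show "(\<forall>(x, y) \<in> st_relations k. v x = v y) \<longleftrightarrow>
    st_relations_hold k (\<lambda>i. v (?s i)) (\<lambda>i. v (?t i))" .
qed

lemma st_congruence: "bool_congruence (free_bool (st_gens k)) (st_congruence k)"
  unfolding st_congruence_def generated_bool_congruence_def
  using bool_congruence_total
    [OF boolean_alg.bool_closed_carrier [OF boolean_alg_free_bool], of "st_gens k"]
    st_relations_closed
  by (intro bool_congruence_Inter) blast+

lemma boolean_alg_st_bool: "boolean_alg (\<B> k)"
proof -
  interpret F: boolean_alg "free_bool (st_gens k)" by (rule boolean_alg_free_bool)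
  have eqI: "(x, y) \<in> st_congruence k" if "x = y" "y \<in> carrier (free_bool (st_gens k))" for x y
    using that bool_congruenceD(2) [OF st_congruence] by simp
  have "bool_laws (free_bool (st_gens k)) (\<lambda>x y. (x, y) \<in> st_congruence k)"
    unfolding bool_laws_def
    by (intro ballI conjI eqI F.bmeet_assoc F.bjoin_assoc F.bmeet_bjoin_distrib F.bjoin_bmeet_distrib
      F.bmeet_bone F.bjoin_bzero F.bmeet_bcompl F.bjoin_bcompl F.bmeet_closed F.bjoin_closed
      F.bzero_closed F.bone_closed; (rule F.bmeet_comm F.bjoin_comm)?; assumption)
  then show ?thesis
    by (simp add: st_bool_def boolean_alg_quotient_iff F.bool_closed_carrier st_congruence)
qed

lemma SGen_mem: "i \<le> k \<Longrightarrow> SGen i \<in> st_gens k" and TGen_mem: "i \<le> k \<Longrightarrow> TGen i \<in> st_gens k"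
  by (auto simp: st_gens_def)

lemma s_elem_closed: "i \<le> k \<Longrightarrow> s_elem k i \<in> carrier (\<B> k)"
  and t_elem_closed: "i \<le> k \<Longrightarrow> t_elem k i \<in> carrier (\<B> k)"
  by (auto simp: s_elem_def t_elem_def st_bool_def bool_quotient_def st_gens_def
      intro!: quotientI free_bool_gen_closed)

lemma st_bool_generated:
  assumes S: "S \<subseteq> carrier (\<B> k)" "\<And>i. i \<le> k \<Longrightarrow> s_elem k i \<in> S" "\<And>i. i \<le> k \<Longrightarrow> t_elem k i \<in> S"
    "bool_closed (\<B> k) S"
  shows "S = carrier (\<B> k)"
proof -
  let ?F = "free_bool (st_gens k)"
  let ?S = "{x \<in> carrier ?F. st_congruence k `` {x} \<in> S}"
  have "bool_closed ?F ?S"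
    using S(4) unfolding st_bool_def
    by (intro bool_closed_preimage [OF st_congruence] boolean_alg.bool_closed_carrier
        boolean_alg_free_bool)
  moreover have "free_bool_gen (st_gens k) ` st_gens k \<subseteq> ?S"
    using S(2,3) by (auto simp: s_elem_def t_elem_def st_gens_def intro!: free_bool_gen_closed)
  ultimately have "?S = carrier ?F" by (intro free_bool_generated) auto
  then have "carrier (\<B> k) \<subseteq> S"
    by (auto simp: st_bool_def bool_quotient_def elim!: quotientE)
  with S(1) show ?thesis by blast
qed

lemma st_bool_valuations_separate:
  assumes "x \<in> carrier (\<B> k)" "y \<in> carrier (\<B> k)" "\<And>v. v \<in> bool_valuations (\<B> k) \<Longrightarrow> v x = v y"
  shows "x = y"
proof (rule ccontr)
  assume "x \<noteq> y"
  then obtain v where "v \<in> bool_valuations (\<B> k)" "v x \<noteq> v y"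
  proof (rule boolean_alg.separated_by_valuations [OF boolean_alg_st_bool, rotated -2])
    show "finite (s_elem k ` {..k} \<union> t_elem k ` {..k})" by simp
    show "s_elem k ` {..k} \<union> t_elem k ` {..k} \<subseteq> carrier (\<B> k)"
      by (auto simp: s_elem_closed t_elem_closed)
    show "S = carrier (\<B> k)" if "S \<subseteq> carrier (\<B> k)" "bool_closed (\<B> k) S"
      "s_elem k ` {..k} \<union> t_elem k ` {..k} \<subseteq> S" for S
      using that by (intro st_bool_generated) auto
  qed (use assms in auto)
  with assms(3) show False by blast
qed

lemma st_bool_valuation_relations:
  assumes "v \<in> bool_valuations (\<B> k)"
  shows "st_relations_hold k (\<lambda>i. v (s_elem k i)) (\<lambda>i. v (t_elem k i))"
proof -
  have v: "(\<lambda>x. v (st_congruence k `` {x})) \<in> bool_valuations (free_bool (st_gens k))"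
    using assms unfolding st_bool_def
    by (intro valuation_of_quotient boolean_alg.bool_closed_carrier boolean_alg_free_bool st_congruence)
  have "st_congruence k `` {x} = st_congruence k `` {y}" if "(x, y) \<in> st_relations k" for x y
  proof (rule equiv_class_eq [OF bool_congruenceD(1) [OF st_congruence]])
    show "(x, y) \<in> st_congruence k"
      using that by (auto simp: st_congruence_def generated_bool_congruence_def)
  qed
  then show ?thesis
    using st_relations_valuation [OF v] by (auto simp: s_elem_def t_elem_def)
qed

lemma st_bool_valuation:
  assumes "st_relations_hold k s t"
  obtains v where "v \<in> bool_valuations (\<B> k)"
    "\<And>i. i \<le> k \<Longrightarrow> v (s_elem k i) \<longleftrightarrow> s i" "\<And>i. i \<le> k \<Longrightarrow> v (t_elem k i) \<longleftrightarrow> t i"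
proof -
  let ?F = "free_bool (st_gens k)"
  have closed: "bool_closed ?F (carrier ?F)"
    by (intro boolean_alg.bool_closed_carrier boolean_alg_free_bool)
  obtain u where u: "u \<in> bool_valuations ?F"
    and g: "\<And>g. g \<in> st_gens k \<Longrightarrow> u (free_bool_gen (st_gens k) g) \<longleftrightarrow> case_st_gen s t g"
    using free_bool_valuation [of "st_gens k" "case_st_gen s t"] by blast
  let ?K = "{(x, y). x \<in> carrier ?F \<and> y \<in> carrier ?F \<and> (u x \<longleftrightarrow> u y)}"
  have st: "u (free_bool_gen (st_gens k) (SGen i)) \<longleftrightarrow> s i"
    "u (free_bool_gen (st_gens k) (TGen i)) \<longleftrightarrow> t i" if "i \<le> k" for i
    using that g [of "SGen i"] g [of "TGen i"] by (simp_all add: SGen_mem TGen_mem)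
  then have "st_relations_hold k (\<lambda>i. u (free_bool_gen (st_gens k) (SGen i)))
      (\<lambda>i. u (free_bool_gen (st_gens k) (TGen i)))"
    using assms by (simp add: st_relations_hold_def)
  then have "st_relations k \<subseteq> ?K"
    using st_relations_closed [of k] st_relations_valuation [OF u] by blast
  then have "st_congruence k \<subseteq> ?K"
    using bool_congruence_kernel [OF closed u]
    unfolding st_congruence_def generated_bool_congruence_def by blast
  then have ker: "u x \<longleftrightarrow> u y" if "(x, y) \<in> st_congruence k" for x y
    using that by blast
  obtain w where "w \<in> bool_valuations (\<B> k)"
    "\<And>x. x \<in> carrier ?F \<Longrightarrow> w (st_congruence k `` {x}) \<longleftrightarrow> u x"
    using quotient_valuation [OF closed st_congruence u ker] unfolding st_bool_def by blast
  then show ?thesis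
    by (intro that [of w])
      (auto simp: s_elem_def t_elem_def st free_bool_gen_closed SGen_mem TGen_mem)
qed


section \<open>Localizations of a cubic implication algebra\<close>

context cubic_implication_algebra
begin

text \<open>
  In a coordinate where \<open>a\<close> is the edge, so are all elements above \<open>a\<close>.  Conversely, if \<open>z\<close> is
  the edge wherever \<open>a\<close> is, then \<open>\<Delta> (a \<squnion> z) z\<close> agrees with \<open>a\<close> or is the edge in every
  coordinate: where \<open>z\<close> is the vertex opposite to \<open>a\<close>, it is the vertex \<open>a\<close>.  So it lies
  above \<open>a\<close>, and applying \<open>\<Delta> (a \<squnion> z)\<close> once more returns \<open>z\<close>.
\<close>
lemma localization_eq:
  assumes a: "a \<in> carrier L"
  shows "localization L a =
    {z \<in> carrier L. \<forall>h\<in>cubic_hom L (\<I> two_bool). h a = (False, True) \<longrightarrow> h z = (False, True)}"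
proof (intro equalityI subsetI)
  fix z assume "z \<in> localization L a"
  then obtain x y where xy: "x \<in> carrier L" "y \<in> carrier L" "a \<sqsubseteq> x" "x \<sqsubseteq> y" "z = \<Delta> y x"
    unfolding localization_def by blast
  have "h z = (False, True)" if h: "h \<in> cubic_hom L (\<I> two_bool)" "h a = (False, True)" for h
  proof -
    note H = cubic_homD [OF h(1)]
    have "h (a \<squnion> x) = h x" "h (x \<squnion> y) = h y" using xy by (simp_all add: cle_def)
    then have "h x = (False, True)" "h y = (False, True)"
      using H(1) [OF xy(1)] H(1) [OF xy(2)] xy(1,2) a h(2) by (auto simp: H(3))
    then show ?thesis using xy by (simp add: H(4))
  qed
  then show "z \<in> {z \<in> carrier L.
      \<forall>h\<in>cubic_hom L (\<I> two_bool). h a = (False, True) \<longrightarrow> h z = (False, True)}"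
    using xy by (auto intro: delta_closed)
next
  fix z assume "z \<in> {z \<in> carrier L.
      \<forall>h\<in>cubic_hom L (\<I> two_bool). h a = (False, True) \<longrightarrow> h z = (False, True)}"
  then have z: "z \<in> carrier L"
    and za: "\<And>h. \<lbrakk>h \<in> cubic_hom L (\<I> two_bool); h a = (False, True)\<rbrakk> \<Longrightarrow> h z = (False, True)"
    by auto
  let ?y = "a \<squnion> z" and ?x = "\<Delta> (a \<squnion> z) z"
  have c: "?y \<in> carrier L" "?x \<in> carrier L" "z \<sqsubseteq> ?y"
    using a z by (auto simp: join_closed delta_closed join_upper2)
  have "a \<squnion> ?x = ?x"
  proof (rule ccontr)
    assume "a \<squnion> ?x \<noteq> ?x"
    then obtain h where h: "h \<in> cubic_hom L (\<I> two_bool)" and ne: "h (a \<squnion> ?x) \<noteq> h ?x"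
      using separated_by_coordinates [of "a \<squnion> ?x" ?x] a c join_closed by metis
    note H = cubic_homD [OF h]
    have "h ?x = \<Delta>\<^bsub>\<I> two_bool\<^esub> (h a \<squnion>\<^bsub>\<I> two_bool\<^esub> h z) (h z)"
      using H(4) [OF c(1) z] H(3) [OF a z] by simp
    with ne have "h a \<squnion>\<^bsub>\<I> two_bool\<^esub> \<Delta>\<^bsub>\<I> two_bool\<^esub> (h a \<squnion>\<^bsub>\<I> two_bool\<^esub> h z) (h z)
        \<noteq> \<Delta>\<^bsub>\<I> two_bool\<^esub> (h a \<squnion>\<^bsub>\<I> two_bool\<^esub> h z) (h z)"
      using H(3) [OF a c(2)] by simp
    then show False
      using za [OF h] interval_two_cases [OF H(1) [OF a]] interval_two_cases [OF H(1) [OF z]]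
      by (elim disjE) simp_all
  qed
  then have "a \<sqsubseteq> ?x" by (simp add: cle_def)
  moreover have "?x \<sqsubseteq> ?y" using z c by (intro delta_le)
  moreover have "z = \<Delta> ?y ?x" using z c by (simp add: delta_involution)
  ultimately show "z \<in> localization L a" using c unfolding localization_def by blast
qed

lemma localization_self: "a \<in> carrier L \<Longrightarrow> a \<in> localization L a"
  by (simp add: localization_eq)

text \<open>
  In each coordinate \<open>x \<squnion> y\<close> and \<open>\<Delta> x y\<close> are the edge when \<open>y\<close> is, so they stay in the
  localization that contains \<open>y\<close>.
\<close>
lemma union_of_localizations_algebra:
  assumes A: "A \<noteq> {}" "A \<subseteq> carrier L"
  shows "cubic_implication_algebra (L\<lparr>carrier := \<Union>a\<in>A. localization L a\<rparr>)"
proof -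
  let ?U = "L\<lparr>carrier := \<Union>a\<in>A. localization L a\<rparr>"
  have sub: "carrier ?U \<subseteq> carrier L"
    using A(2) localization_eq by auto
  have "\<one> \<in> carrier ?U"
    using A localization_eq by (auto simp: one_closed cubic_homD(2) subset_eq)
  moreover have "x \<squnion> y \<in> carrier ?U" "\<Delta> x y \<in> carrier ?U"
    if xy: "x \<in> carrier ?U" "y \<in> carrier ?U" for x y
  proof -
    obtain a where a: "a \<in> A" "y \<in> localization L a" using xy(2) by auto
    then have aL: "a \<in> carrier L" and xL: "x \<in> carrier L" and yL: "y \<in> carrier L"
      using A(2) xy sub by blast+
    have "h (x \<squnion> y) = (False, True) \<and> h (\<Delta> x y) = (False, True)"
      if h: "h \<in> cubic_hom L (\<I> two_bool)" "h a = (False, True)" for h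
    proof -
      have "h y = (False, True)" using a(2) h by (simp add: localization_eq [OF aL])
      then show ?thesis
        using cubic_homD(1) [OF h(1) xL] by (auto simp: cubic_homD [OF h(1)] xL yL)
    qed
    then have "x \<squnion> y \<in> localization L a" "\<Delta> x y \<in> localization L a"
      using xL yL by (auto simp: localization_eq [OF aL] join_closed delta_closed)
    then show "x \<squnion> y \<in> carrier ?U" "\<Delta> x y \<in> carrier ?U" using a(1) by auto
  qed
  ultimately have closed: "cubic_closed ?U" by (simp add: cubic_closed_def)
  \<comment> \<open>A closed subset inherits the axioms, being separated by its inclusion.\<close>
  show ?thesis
  proof (rule cubic_implication_algebra_separated
      [where I = "{()}" and M = "\<lambda>_. L" and h = "\<lambda>_ x. x", OF closed])
    show "cubic_implication_algebra L" by (rule cubic_implication_algebra_axioms)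
    show "(\<lambda>x. x) \<in> cubic_hom ?U L"
      using sub by (auto simp: cubic_hom_def)
  qed auto
qed

end


section \<open>Interval algebras of Boolean algebras separated by valuations\<close>

locale separated_boolean_alg = boolean_alg B
  for B :: "('b, 'm) bool_struct_scheme" (structure) +
  assumes separated: "\<lbrakk>x \<in> carrier B; y \<in> carrier B;
    \<And>v. v \<in> bool_valuations B \<Longrightarrow> v x = v y\<rbrakk> \<Longrightarrow> x = y"
begin

lemmas bool_ops_closed = bzero_closed bone_closed bmeet_closed bjoin_closed bcompl_closed

lemma interval_carrier_iff:
  "(a, b) \<in> carrier (\<I> B) \<longleftrightarrow>
    a \<in> carrier B \<and> b \<in> carrier B \<and> (\<forall>v\<in>bool_valuations B. v a \<longrightarrow> v b)"
proof -
  have "a \<curlywedge> b = a \<longleftrightarrow> (\<forall>v\<in>bool_valuations B. v a \<longrightarrow> v b)" if "a \<in> carrier B" "b \<in> carrier B"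
  proof
    show "\<forall>v\<in>bool_valuations B. v a \<longrightarrow> v b" if "a \<curlywedge> b = a"
      using that bool_valuationD(3) [OF _ \<open>a \<in> carrier B\<close> \<open>b \<in> carrier B\<close>] by metis
    show "a \<curlywedge> b = a" if "\<forall>v\<in>bool_valuations B. v a \<longrightarrow> v b"
      using that \<open>a \<in> carrier B\<close> \<open>b \<in> carrier B\<close>
      by (intro separated) (auto simp: bool_ops_closed bool_valuationD(3))
  qed
  then show ?thesis by (auto simp: interval_algebra_def ble_def)
qed

lemma interval_ops:
  "\<one>\<^bsub>\<I> B\<^esub> = (\<bottom>, \<top>)"
  "(a, b) \<squnion>\<^bsub>\<I> B\<^esub> (c, d) = (a \<curlywedge> c, b \<curlyvee> d)"
  "\<Delta>\<^bsub>\<I> B\<^esub> (a, b) (c, d) = ((a \<curlywedge> c) \<curlyvee> ((b \<curlyvee> d) \<curlywedge> \<ominus> d), (b \<curlyvee> d) \<curlywedge> ((a \<curlywedge> c) \<curlyvee> \<ominus> c))"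
  by (simp_all add: interval_algebra_def interval_join_def interval_delta_def)

lemma interval_closed: "cubic_closed (\<I> B)"
  unfolding cubic_closed_def
  by (auto simp: interval_ops interval_carrier_iff bool_ops_closed bool_valuationD)

lemma interval_valuation_hom:
  assumes "v \<in> bool_valuations B"
  shows "map_prod v v \<in> cubic_hom (\<I> B) (\<I> two_bool)"
  unfolding cubic_hom_def
  using assms
  by (auto simp: interval_ops interval_carrier_iff bool_ops_closed bool_valuationD)

lemma interval_separated:
  assumes "p \<in> carrier (\<I> B)" "q \<in> carrier (\<I> B)"
    "\<And>v. v \<in> bool_valuations B \<Longrightarrow> map_prod v v p = map_prod v v q"
  shows "p = q"
  using assms by (cases p; cases q) (auto simp: interval_carrier_iff intro!: separated)

lemma cubic_interval_algebra: "cubic_implication_algebra (\<I> B)"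
  by (rule cubic_implication_algebra_separated [where I = "bool_valuations B"
        and M = "\<lambda>_. \<I> two_bool" and h = "\<lambda>v. map_prod v v"])
    (rule interval_closed cubic_interval_two interval_valuation_hom interval_separated; assumption?)+

text \<open>
  A valuation turns an interval into an element of \<open>\<I> 2\<close>; the width is the region where this is the
  edge, and widening by \<open>b\<close> makes it the edge on \<open>b\<close>.
\<close>
definition width :: "'b \<times> 'b \<Rightarrow> 'b"
  where "width p = \<ominus> fst p \<curlywedge> snd p"

definition widen :: "'b \<times> 'b \<Rightarrow> 'b \<Rightarrow> 'b \<times> 'b"
  where "widen p b = (fst p \<curlywedge> \<ominus> b, snd p \<curlyvee> b)"

lemma endpoints_closed: "p \<in> carrier (\<I> B) \<Longrightarrow> fst p \<in> carrier B \<and> snd p \<in> carrier B"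
  using interval_carrier_iff [of "fst p" "snd p"] by simp

lemma width_closed: "p \<in> carrier (\<I> B) \<Longrightarrow> width p \<in> carrier B"
  by (simp add: width_def endpoints_closed bool_ops_closed)

lemma width_valuation:
  "\<lbrakk>v \<in> bool_valuations B; p \<in> carrier (\<I> B)\<rbrakk> \<Longrightarrow> v (width p) \<longleftrightarrow> map_prod v v p = (False, True)"
  by (simp add: width_def endpoints_closed bool_ops_closed bool_valuationD prod_eq_iff)

lemma widen_closed:
  assumes p: "p \<in> carrier (\<I> B)" and b: "b \<in> carrier B"
  shows "widen p b \<in> carrier (\<I> B)"
proof -
  have "v (fst p) \<longrightarrow> v (snd p)" if "v \<in> bool_valuations B" for v
    using p that interval_carrier_iff [of "fst p" "snd p"] unfolding prod.collapse by blast
  then show ?thesis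
    unfolding widen_def interval_carrier_iff
    by (simp add: endpoints_closed [OF p] b bool_ops_closed bool_valuationD) blast
qed

lemma widen_valuation:
  "\<lbrakk>v \<in> bool_valuations B; p \<in> carrier (\<I> B); b \<in> carrier B\<rbrakk>
    \<Longrightarrow> map_prod v v (widen p b) = (if v b then (False, True) else map_prod v v p)"
  by (simp add: widen_def endpoints_closed bool_ops_closed bool_valuationD prod_eq_iff)

lemma widen_cong:
  assumes p: "p \<in> carrier (\<I> B)" and b: "b \<in> carrier B" "c \<in> carrier B"
    and eq: "\<And>v. \<lbrakk>v \<in> bool_valuations B; map_prod v v p \<noteq> (False, True)\<rbrakk> \<Longrightarrow> v b = v c"
  shows "widen p b = widen p c"
proof (rule interval_separated)
  fix v assume v: "v \<in> bool_valuations B"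
  show "map_prod v v (widen p b) = map_prod v v (widen p c)"
    using eq [OF v] by (simp add: widen_valuation v p b) metis
qed (use p b in \<open>auto simp: widen_closed\<close>)

lemma widen_width:
  assumes p: "p \<in> carrier (\<I> B)" and q: "q \<in> carrier (\<I> B)" and le: "p \<sqsubseteq>\<^bsub>\<I> B\<^esub> q"
  shows "widen p (width q) = q"
proof (rule interval_separated)
  fix v assume v: "v \<in> bool_valuations B"
  note H = cubic_homD [OF interval_valuation_hom [OF v]]
  have "map_prod v v (p \<squnion>\<^bsub>\<I> B\<^esub> q) = map_prod v v q" using le by (simp add: cle_def)
  then show "map_prod v v (widen p (width q)) = map_prod v v q"
    using interval_two_cases [OF H(1) [OF p]] interval_two_cases [OF H(1) [OF q]]
    by (auto simp: widen_valuation [OF v p width_closed [OF q]] width_valuation [OF v q] H(3) [OF p q])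
qed (use p q in \<open>auto simp: widen_closed width_closed\<close>)

text \<open>
  The elements above \<open>p\<close> form a Boolean algebra whose join is that of the interval algebra and where
  the complement of \<open>x\<close> is \<open>x \<odot> p\<close>; hence the elements above \<open>p\<close> of a subalgebra that contains
  \<open>p\<close> correspond to a Boolean subalgebra.
\<close>
lemma bool_closed_widen:
  assumes S: "S \<subseteq> carrier (\<I> B)" "\<one>\<^bsub>\<I> B\<^esub> \<in> S"
    "\<And>x y. \<lbrakk>x \<in> S; y \<in> S\<rbrakk> \<Longrightarrow> x \<squnion>\<^bsub>\<I> B\<^esub> y \<in> S" "\<And>x y. \<lbrakk>x \<in> S; y \<in> S\<rbrakk> \<Longrightarrow> \<Delta>\<^bsub>\<I> B\<^esub> x y \<in> S"
    and p: "p \<in> S"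
  shows "bool_closed B {b \<in> carrier B. widen p b \<in> S}"
proof -
  let ?A = "{b \<in> carrier B. widen p b \<in> S}"
  have pI: "p \<in> carrier (\<I> B)" using S p by blast
  note one = cubic_implication_algebra.one_closed [OF cubic_interval_algebra]
  have "widen p \<bottom> = p" "widen p \<top> = \<one>\<^bsub>\<I> B\<^esub>"
    using pI one cubic_homD(2) [OF interval_valuation_hom]
    by (auto intro!: interval_separated simp: widen_closed widen_valuation bool_ops_closed bool_valuationD)
  then have 1: "\<bottom> \<in> ?A" "\<top> \<in> ?A" using p S(2) by (auto simp: bool_ops_closed)
  have join: "b \<curlyvee> c \<in> ?A" if "b \<in> ?A" "c \<in> ?A" for b c
  proof -
    have bc: "b \<in> carrier B" "c \<in> carrier B" using that by auto
    note w = widen_closed [OF pI bc(1)] widen_closed [OF pI bc(2)]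
    have "widen p (b \<curlyvee> c) = widen p b \<squnion>\<^bsub>\<I> B\<^esub> widen p c"
    proof (rule interval_separated)
      fix v assume v: "v \<in> bool_valuations B"
      note H = cubic_homD [OF interval_valuation_hom [OF v]]
      show "map_prod v v (widen p (b \<curlyvee> c)) = map_prod v v (widen p b \<squnion>\<^bsub>\<I> B\<^esub> widen p c)"
        using interval_two_cases [OF H(1) [OF pI]] bc
        by (auto simp: widen_valuation [OF v pI] H(3) [OF w] bool_ops_closed bool_valuationD [OF v])
    qed (use pI bc w in \<open>auto simp: widen_closed bool_ops_closed
        cubic_implication_algebra.join_closed [OF cubic_interval_algebra]\<close>)
    then show ?thesis using that S(3) bc by (simp add: bool_ops_closed)
  qed
  have compl: "\<ominus> b \<in> ?A" if "b \<in> ?A" for b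
  proof -
    have b: "b \<in> carrier B" using that by auto
    note w = widen_closed [OF pI b]
    have wS: "widen p b \<in> S" using that by simp
    note clS = S(3) [OF wS p] S(4) [OF S(3) [OF wS p] p]
      S(4) [OF S(2) S(4) [OF S(3) [OF wS p] p]]
    have c: "widen p b \<odot>\<^bsub>\<I> B\<^esub> p \<in> S"
      unfolding cprod_def by (rule S(3) [OF clS(3) p])
    have "widen p (\<ominus> b) = widen p b \<odot>\<^bsub>\<I> B\<^esub> p"
    proof (rule interval_separated)
      fix v assume v: "v \<in> bool_valuations B"
      note H = cubic_homD [OF interval_valuation_hom [OF v]]
      note cl = clS [THEN subsetD [OF S(1)]]
      show "map_prod v v (widen p (\<ominus> b)) = map_prod v v (widen p b \<odot>\<^bsub>\<I> B\<^esub> p)"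
        unfolding cprod_def H(3) [OF cl(3) pI] H(4) [OF one cl(2)] H(4) [OF cl(1) pI]
          H(3) [OF w pI] H(2)
        using interval_two_cases [OF H(1) [OF pI]] b
        by (auto simp: widen_valuation [OF v pI] bool_ops_closed bool_valuationD [OF v])
    qed (use pI b c S in \<open>auto simp: widen_closed bool_ops_closed\<close>)
    then show ?thesis using c b by (simp add: bool_ops_closed)
  qed
  have meet: "b \<curlywedge> c \<in> ?A" if "b \<in> ?A" "c \<in> ?A" for b c
  proof -
    have "b \<curlywedge> c = \<ominus> (\<ominus> b \<curlyvee> \<ominus> c)"
      using that by (intro separated) (auto simp: bool_ops_closed bool_valuationD)
    then show ?thesis using compl [OF join [OF compl [OF that(1)] compl [OF that(2)]]] by simp
  qed
  show ?thesis unfolding bool_closed_def by (intro conjI ballI 1 join meet compl)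
qed

end


section \<open>The intervals \<open>[s_i, t_i]\<close> generate the union of their localizations\<close>

interpretation st: separated_boolean_alg "\<B> k" for k
  by (intro separated_boolean_alg.intro separated_boolean_alg_axioms.intro boolean_alg_st_bool
      st_bool_valuations_separate)

definition st_interval :: "nat \<Rightarrow> nat \<Rightarrow> st_gen bool_term set set \<times> st_gen bool_term set set"
  where "st_interval k i = (s_elem k i, t_elem k i)"

lemma st_interval_closed: "i \<le> k \<Longrightarrow> st_interval k i \<in> carrier (\<I> (\<B> k))"
  using st_bool_valuation_relations
  by (auto simp: st_interval_def st.interval_carrier_iff s_elem_closed t_elem_closed st_relations_hold_def)

lemma union_localizations_eq:
  "union_localizations k = (\<I> (\<B> k))\<lparr>carrier := \<Union>a\<in>st_interval k ` {..k}. localization (\<I> (\<B> k)) a\<rparr>"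
  by (simp add: union_localizations_def st_interval_def)

lemma union_localizations_algebra: "cubic_implication_algebra (union_localizations k)"
  unfolding union_localizations_eq
  by (intro cubic_implication_algebra.union_of_localizations_algebra st.cubic_interval_algebra)
    (auto simp: st_interval_closed)

text \<open>
  For positive \<open>m\<close> the relation \<open>t_0 \<le> s_1 \<or> \<dots> \<or> s_(m-1) \<or> t_m\<close> applies: its left
  side holds and the \<open>s_j\<close> vanish because the earlier intervals are edges, so \<open>t_m\<close> holds, which
  leaves \<open>[1, 1]\<close>.
\<close>
lemma first_nontrivial_sign:
  assumes v: "v \<in> bool_valuations (\<B> k)" and m: "m \<le> k"
    and before: "\<And>j. j < m \<Longrightarrow> map_prod v v (st_interval k j) = (False, True)"
    and at: "map_prod v v (st_interval k m) \<noteq> (False, True)"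
  shows "map_prod v v (st_interval k m) = (m \<noteq> 0, m \<noteq> 0)"
proof -
  let ?s = "\<lambda>i. v (s_elem k i)" and ?t = "\<lambda>i. v (t_elem k i)"
  have R: "\<not> ?s 0" "\<And>i. i \<le> k \<Longrightarrow> ?s i \<Longrightarrow> ?t i"
    "\<And>i. \<lbrakk>i < k; ?t 0\<rbrakk> \<Longrightarrow> (\<exists>j\<in>{1..i}. ?s j) \<or> ?t (i + 1)"
    using st_bool_valuation_relations [OF v] unfolding st_relations_hold_def by blast+
  have b: "\<not> ?s j \<and> ?t j" if "j < m" for j using before [OF that] by (simp add: st_interval_def)
  have a: "?s m \<or> \<not> ?t m" using at by (simp add: st_interval_def)
  show ?thesis
  proof (cases m)
    case 0
    then show ?thesis using a R(1) by (simp add: st_interval_def)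
  next
    case (Suc i)
    then have "?t m" using R(3) [of i] b m by auto
    then show ?thesis using a Suc by (simp add: st_interval_def)
  qed
qed

text \<open>
  Everything is reduced to one index \<open>i\<close> and to the Boolean subalgebra \<open>A\<close> of those \<open>b\<close> by which
  \<open>g i\<close> can be widened inside \<open>S\<close>.  Only valuations at which \<open>g i\<close> is a vertex matter for
  membership in \<open>A\<close> (\<open>widen_cong\<close>), and there \<open>D1 j\<close> and \<open>D2 j\<close> say that \<open>g j\<close> differs from
  \<open>g i\<close> and from its opposite vertex.
\<close>
lemma st_intervals_generate:
  assumes S: "S \<subseteq> carrier (\<I> (\<B> k))" "\<one>\<^bsub>\<I> (\<B> k)\<^esub> \<in> S"
    "\<And>x y. \<lbrakk>x \<in> S; y \<in> S\<rbrakk> \<Longrightarrow> x \<squnion>\<^bsub>\<I> (\<B> k)\<^esub> y \<in> S"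
    "\<And>x y. \<lbrakk>x \<in> S; y \<in> S\<rbrakk> \<Longrightarrow> \<Delta>\<^bsub>\<I> (\<B> k)\<^esub> x y \<in> S"
    and gS: "\<And>i. i \<le> k \<Longrightarrow> st_interval k i \<in> S"
  shows "carrier (union_localizations k) \<subseteq> S"
proof -
  interpret I: cubic_implication_algebra "\<I> (\<B> k)" by (rule st.cubic_interval_algebra)
  let ?g = "st_interval k" and ?V = "bool_valuations (\<B> k)"
  have above: "x \<in> S" if i: "i \<le> k" and x: "x \<in> carrier (\<I> (\<B> k))" "?g i \<sqsubseteq>\<^bsub>\<I> (\<B> k)\<^esub> x" for i x
  proof -
    let ?A = "{b \<in> carrier (\<B> k). st.widen k (?g i) b \<in> S}"
    note g = st_interval_closed [OF i]
    have closed: "bool_closed (\<B> k) ?A"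
      by (rule st.bool_closed_widen [OF S gS [OF i]])
    note A = bool_closedD [OF closed]
    have AB: "b \<in> carrier (\<B> k)" if "b \<in> ?A" for b using that by simp
    have cong: "c \<in> ?A" if "b \<in> ?A" "c \<in> carrier (\<B> k)"
      "\<And>v. \<lbrakk>v \<in> ?V; map_prod v v (?g i) \<noteq> (False, True)\<rbrakk> \<Longrightarrow> v b = v c" for b c
      using st.widen_cong [OF g _ that(2), of b] that by auto
    define D where "D x = st.width k (?g i \<squnion>\<^bsub>\<I> (\<B> k)\<^esub> x)" for x
    have D: "D x \<in> ?A" if "x \<in> S" for x
    proof -
      have x: "x \<in> carrier (\<I> (\<B> k))" using that S(1) by blast
      have "st.widen k (?g i) (D x) = ?g i \<squnion>\<^bsub>\<I> (\<B> k)\<^esub> x"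
        unfolding D_def by (intro st.widen_width g I.join_closed x I.join_upper1)
      then show ?thesis
        using S(3) [OF gS [OF i] that] unfolding D_def
        by (simp add: st.width_closed I.join_closed g x)
    qed
    have Dv: "v (D x) \<longleftrightarrow> map_prod v v (?g i) \<squnion>\<^bsub>\<I> two_bool\<^esub> map_prod v v x = (False, True)"
      if "v \<in> ?V" "x \<in> S" for v x
      using that S(1) g cubic_homD(3) [OF st.interval_valuation_hom [OF that(1)] g, of x]
      by (auto simp: D_def st.width_valuation I.join_closed)
    define D1 where "D1 j = D (?g j)" for j
    define D2 where "D2 j = D (\<Delta>\<^bsub>\<I> (\<B> k)\<^esub> \<one>\<^bsub>\<I> (\<B> k)\<^esub> (?g j))" for j
    have D12: "D1 j \<in> ?A" "D2 j \<in> ?A" if "j \<le> k" for j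
      unfolding D1_def D2_def by (intro D S gS that)+
    have D1v: "v (D1 j) \<longleftrightarrow> map_prod v v (?g j) \<noteq> map_prod v v (?g i)"
      and D2v: "v (D2 j) \<longleftrightarrow> map_prod v v (?g j) \<noteq> (\<not> v (t_elem k i), \<not> v (s_elem k i))"
      if v: "v \<in> ?V" "map_prod v v (?g i) \<noteq> (False, True)" and j: "j \<le> k" for v j
    proof -
      note H = cubic_homD [OF st.interval_valuation_hom [OF v(1)]]
      show "v (D1 j) \<longleftrightarrow> map_prod v v (?g j) \<noteq> map_prod v v (?g i)"
        using interval_two_cases [OF H(1) [OF g]] interval_two_cases [OF H(1) [OF st_interval_closed [OF j]]]
          v(2) unfolding D1_def Dv [OF v(1) gS [OF j]] by auto
      show "v (D2 j) \<longleftrightarrow> map_prod v v (?g j) \<noteq> (\<not> v (t_elem k i), \<not> v (s_elem k i))"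
        using interval_two_cases [OF H(1) [OF g]] interval_two_cases [OF H(1) [OF st_interval_closed [OF j]]]
          v(2) unfolding D2_def Dv [OF v(1) S(4) [OF S(2) gS [OF j]]]
            H(4) [OF I.one_closed st_interval_closed [OF j]] H(2)
        by (auto simp: st_interval_def)
    qed
    \<comment> \<open>To get \<open>s_i\<close> into \<open>A\<close>, scan \<open>g 0, g 1, \<dots>\<close> for the first vertex: \<open>T\<close> says that there is
      none among the first \<open>m\<close>, and \<open>Q\<close> agrees with \<open>s_i\<close> if there is one.  The scan ends at
      \<open>i\<close>, because \<open>g i\<close> is a vertex.\<close>
    have "\<exists>T\<in>?A. \<exists>Q\<in>?A. \<forall>v\<in>?V. map_prod v v (?g i) \<noteq> (False, True) \<longrightarrow>
        (v T \<longleftrightarrow> (\<forall>j<m. map_prod v v (?g j) = (False, True))) \<and>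
        ((\<exists>j<m. map_prod v v (?g j) \<noteq> (False, True)) \<longrightarrow> (v Q \<longleftrightarrow> v (s_elem k i)))"
      if "m \<le> Suc i" for m
      using that
    proof (induction m)
      case 0
      show ?case
        by (rule bexI [OF _ A(2)], rule bexI [OF _ A(1)]) (simp add: bool_valuationD(2))
    next
      case (Suc m)
      then have mk: "m \<le> k" using i by simp
      from Suc obtain T Q where T: "T \<in> ?A" and Q: "Q \<in> ?A"
        and TQ: "\<And>v. \<lbrakk>v \<in> ?V; map_prod v v (?g i) \<noteq> (False, True)\<rbrakk> \<Longrightarrow>
          (v T \<longleftrightarrow> (\<forall>j<m. map_prod v v (?g j) = (False, True))) \<and>
          ((\<exists>j<m. map_prod v v (?g j) \<noteq> (False, True)) \<longrightarrow> (v Q \<longleftrightarrow> v (s_elem k i)))"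
        by auto
      \<comment> \<open>A first vertex at \<open>m\<close> is \<open>[0, 0]\<close> if \<open>m = 0\<close> and \<open>[1, 1]\<close> otherwise, so \<open>g i\<close> is
        \<open>[1, 1]\<close> iff it differs from \<open>g m\<close> in the first case, and from its opposite in the second.\<close>
      let ?X = "if m = 0 then D1 m else D2 m"
      let ?T = "T \<curlywedge>\<^bsub>\<B> k\<^esub> (D1 m \<curlywedge>\<^bsub>\<B> k\<^esub> D2 m)"
      let ?Q = "(T \<curlywedge>\<^bsub>\<B> k\<^esub> ?X) \<curlyvee>\<^bsub>\<B> k\<^esub> (\<ominus>\<^bsub>\<B> k\<^esub> T \<curlywedge>\<^bsub>\<B> k\<^esub> Q)"
      have X: "?X \<in> ?A" using D12 [OF mk] by (cases "m = 0") simp_all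
      note c = AB [OF T] AB [OF Q] AB [OF X] AB [OF D12(1) [OF mk]] AB [OF D12(2) [OF mk]]
      have "(v ?T \<longleftrightarrow> (\<forall>j<Suc m. map_prod v v (?g j) = (False, True))) \<and>
          ((\<exists>j<Suc m. map_prod v v (?g j) \<noteq> (False, True)) \<longrightarrow> (v ?Q \<longleftrightarrow> v (s_elem k i)))"
        if v: "v \<in> ?V" "map_prod v v (?g i) \<noteq> (False, True)" for v
      proof -
        note H = cubic_homD [OF st.interval_valuation_hom [OF v(1)]]
        have gi: "v (s_elem k i) \<longleftrightarrow> v (t_elem k i)"
          using interval_two_cases [OF H(1) [OF g]] v(2) by (auto simp: st_interval_def)
        have vT: "v ?T \<longleftrightarrow> v T \<and> map_prod v v (?g m) = (False, True)"
          using interval_two_cases [OF H(1) [OF st_interval_closed [OF mk]]] gi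
          by (auto simp: c st.bool_ops_closed bool_valuationD [OF v(1)] D1v [OF v mk] D2v [OF v mk]
              st_interval_def)
        have vQ: "v ?Q \<longleftrightarrow> (if v T then v ?X else v Q)"
          using c by (simp add: st.bool_ops_closed bool_valuationD [OF v(1)])
        have vX: "v ?X \<longleftrightarrow> v (s_elem k i)"
          if "v T" "map_prod v v (?g m) \<noteq> (False, True)"
        proof -
          have "map_prod v v (?g m) = (m \<noteq> 0, m \<noteq> 0)"
            using that TQ [OF v] by (intro first_nontrivial_sign v mk) auto
          then show ?thesis using gi D1v [OF v mk] D2v [OF v mk] by (auto simp: st_interval_def)
        qed
        show ?thesis
          using TQ [OF v] vX unfolding vT vQ less_Suc_eq by auto
      qed
      moreover have "?T \<in> ?A" by (intro A(3) T D12 mk)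
      moreover have "?Q \<in> ?A" by (intro A(3-5) T Q X)
      ultimately show ?case by blast
    qed
    from this [of "Suc i"] obtain Q where Q: "Q \<in> ?A"
      and Qv: "\<And>v. \<lbrakk>v \<in> ?V; map_prod v v (?g i) \<noteq> (False, True)\<rbrakk> \<Longrightarrow> v Q \<longleftrightarrow> v (s_elem k i)"
      by auto
    have sA: "s_elem k i \<in> ?A"
      using Q s_elem_closed [OF i] by (rule cong) (rule Qv)
    have "?A = carrier (\<B> k)"
    proof (rule st_bool_generated)
      fix j assume j: "j \<le> k"
      let ?s = "s_elem k i"
      note c = AB [OF sA] AB [OF D12(1) [OF j]] AB [OF D12(2) [OF j]]
      \<comment> \<open>Where \<open>g i\<close> is \<open>[1, 1]\<close>, the interval \<open>g j\<close> is \<open>[1, 1]\<close> iff \<open>D1 j\<close> fails and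
        \<open>[0, 0]\<close> iff \<open>D2 j\<close> fails; where \<open>g i\<close> is \<open>[0, 0]\<close> the roles are exchanged.\<close>
      show "s_elem k j \<in> ?A"
      proof (rule cong)
        show "(?s \<curlywedge>\<^bsub>\<B> k\<^esub> \<ominus>\<^bsub>\<B> k\<^esub> (D1 j)) \<curlyvee>\<^bsub>\<B> k\<^esub> (\<ominus>\<^bsub>\<B> k\<^esub> ?s \<curlywedge>\<^bsub>\<B> k\<^esub> \<ominus>\<^bsub>\<B> k\<^esub> (D2 j)) \<in> ?A"
          by (intro A sA D12 j)
        fix v assume v: "v \<in> ?V" "map_prod v v (?g i) \<noteq> (False, True)"
        note H = cubic_homD [OF st.interval_valuation_hom [OF v(1)]]
        show "v ((?s \<curlywedge>\<^bsub>\<B> k\<^esub> \<ominus>\<^bsub>\<B> k\<^esub> (D1 j)) \<curlyvee>\<^bsub>\<B> k\<^esub> (\<ominus>\<^bsub>\<B> k\<^esub> ?s \<curlywedge>\<^bsub>\<B> k\<^esub> \<ominus>\<^bsub>\<B> k\<^esub> (D2 j))) = v (s_elem k j)"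
          using interval_two_cases [OF H(1) [OF st_interval_closed [OF j]]]
            interval_two_cases [OF H(1) [OF g]] v(2)
          by (auto simp: c st.bool_ops_closed bool_valuationD [OF v(1)] D1v [OF v j] D2v [OF v j]
              st_interval_def)
      qed (rule s_elem_closed [OF j])
      show "t_elem k j \<in> ?A"
      proof (rule cong)
        show "(?s \<curlywedge>\<^bsub>\<B> k\<^esub> D2 j) \<curlyvee>\<^bsub>\<B> k\<^esub> (\<ominus>\<^bsub>\<B> k\<^esub> ?s \<curlywedge>\<^bsub>\<B> k\<^esub> D1 j) \<in> ?A"
          by (intro A sA D12 j)
        fix v assume v: "v \<in> ?V" "map_prod v v (?g i) \<noteq> (False, True)"
        note H = cubic_homD [OF st.interval_valuation_hom [OF v(1)]]
        show "v ((?s \<curlywedge>\<^bsub>\<B> k\<^esub> D2 j) \<curlyvee>\<^bsub>\<B> k\<^esub> (\<ominus>\<^bsub>\<B> k\<^esub> ?s \<curlywedge>\<^bsub>\<B> k\<^esub> D1 j)) = v (t_elem k j)"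
          using interval_two_cases [OF H(1) [OF st_interval_closed [OF j]]]
            interval_two_cases [OF H(1) [OF g]] v(2)
          by (auto simp: c st.bool_ops_closed bool_valuationD [OF v(1)] D1v [OF v j] D2v [OF v j]
              st_interval_def)
      qed (rule t_elem_closed [OF j])
    qed (use closed in auto)
    then have "st.width k x \<in> ?A" using st.width_closed [OF x(1)] by blast
    then show "x \<in> S" by (simp add: st.widen_width [OF g x])
  qed
  show ?thesis
  proof
    fix z assume "z \<in> carrier (union_localizations k)"
    then obtain i where i: "i \<le> k" and z: "z \<in> localization (\<I> (\<B> k)) (?g i)"
      by (auto simp: union_localizations_eq)
    then obtain x y where xy: "x \<in> carrier (\<I> (\<B> k))" "y \<in> carrier (\<I> (\<B> k))"
      "?g i \<sqsubseteq>\<^bsub>\<I> (\<B> k)\<^esub> x" "x \<sqsubseteq>\<^bsub>\<I> (\<B> k)\<^esub> y" "z = \<Delta>\<^bsub>\<I> (\<B> k)\<^esub> y x"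
      unfolding localization_def by blast
    moreover have "?g i \<sqsubseteq>\<^bsub>\<I> (\<B> k)\<^esub> y"
      using I.le_trans [OF st_interval_closed [OF i]] xy by blast
    ultimately show "z \<in> S" using above [OF i] S(4) by simp
  qed
qed


section \<open>The free cubic implication algebra\<close>

text \<open>
  Once \<open>t_0\<close> holds, the first vertex \<open>m\<close> has a positive index.  The relation with index \<open>i\<close>
  then follows from \<open>t_(i+1)\<close> if \<open>i < m\<close>, and from \<open>s_m\<close> otherwise.
\<close>
lemma st_relations_hold_normalized:
  assumes m: "m \<le> k" and before: "\<And>j. j < m \<Longrightarrow> \<not> s j \<and> t j" and at: "s m = (m \<noteq> 0)" "t m = (m \<noteq> 0)"
    and le: "\<And>i. i \<le> k \<Longrightarrow> s i \<Longrightarrow> t i"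
  shows "st_relations_hold k s t"
proof (cases "m = 0")
  case True
  then show ?thesis using assms by (simp add: st_relations_hold_def)
next
  case False
  have "(\<exists>j\<in>{1..i}. s j) \<or> t (i + 1)" for i
  proof (cases "m \<le> i")
    case True
    then show ?thesis using False at by (intro disjI1 bexI [of _ m]) auto
  next
    case *: False
    then show ?thesis using before [of "i + 1"] at False by (cases "i + 1 = m") auto
  qed
  moreover have "\<exists>j\<in>{1..k}. s j" using m at False by (intro bexI [of _ m]) auto
  ultimately show ?thesis
    using before [of 0] False le by (auto simp: st_relations_hold_def)
qed

lemma free_cubic_gen_closed: "x \<in> X \<Longrightarrow> free_cubic_gen X x \<in> carrier (\<F>r X)"
  by (auto simp: free_cubic_gen_def free_cubic_def cubic_quotient_def intro: quotientI)

lemma cubic_iso_inverse: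
  assumes L: "cubic_implication_algebra L" and M: "cubic_implication_algebra M"
    and h: "h \<in> cubic_hom M L" "inj_on h (carrier M)" "h ` carrier M = carrier L"
  shows "L \<simeq>\<^sub>c M"
proof -
  interpret L: cubic_implication_algebra L by (rule L)
  interpret M: cubic_implication_algebra M by (rule M)
  let ?g = "the_inv_into (carrier M) h"
  note H = cubic_homD [OF h(1)]
  have bij: "bij_betw ?g (carrier L) (carrier M)"
    using h by (intro bij_betw_the_inv_into) (simp add: bij_betw_def)
  have g: "?g (h x) = x" if "x \<in> carrier M" for x
    using h(2) that by (rule the_inv_into_f_f)
  have "?g \<in> cubic_hom L M"
    unfolding cubic_hom_def h(3) [symmetric]
    using g M.join_closed M.delta_closed g [OF M.one_closed]
    by (auto simp: H(3,4) [symmetric] H(2))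
  then show ?thesis using L M bij unfolding cubic_iso_def by blast
qed

theorem theorem6p15:
  fixes k :: nat and a :: "nat \<Rightarrow> 'x" and X :: "'x set"
  assumes "inj_on a {0..k}" and "X = a ` {0..k}"
  shows "union_localizations k \<simeq>\<^sub>c \<F>r X"
proof -
  let ?L = "union_localizations k" and ?I = "\<I> (\<B> k)"
  interpret F: cubic_implication_algebra "\<F>r X" by (rule free_cubic_algebra)
  interpret I: cubic_implication_algebra ?I by (rule st.cubic_interval_algebra)
  note L = union_localizations_algebra [of k]
  have Lops: "\<one>\<^bsub>?L\<^esub> = \<one>\<^bsub>?I\<^esub>" "cjoin ?L = cjoin ?I" "delta ?L = delta ?I"
    by (simp_all add: union_localizations_eq)
  have LI: "carrier ?L \<subseteq> carrier ?I"
    using st_interval_closed by (auto simp: union_localizations_eq I.localization_eq)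
  let ?gen = "\<lambda>i. free_cubic_gen X (a i)"
  have gen: "?gen i \<in> carrier (\<F>r X)" if "i \<le> k" for i
    using that assms(2) by (auto intro: free_cubic_gen_closed)
  define f where "f x = st_interval k (the_inv_into {0..k} a x)" for x
  have f: "f (a i) = st_interval k i" if "i \<le> k" for i
    using that by (simp add: f_def the_inv_into_f_f [OF assms(1)])
  have gL: "st_interval k i \<in> carrier ?L" if "i \<le> k" for i
    using I.localization_self [OF st_interval_closed [OF that]] that
    by (auto simp: union_localizations_eq)
  have "f \<in> X \<rightarrow> carrier ?L" using assms(2) f gL by auto
  then obtain h where h: "h \<in> cubic_hom (\<F>r X) ?L" and hg: "\<forall>x\<in>X. h (free_cubic_gen X x) = f x"
    using free_cubic_universal(1) [OF L] by blast
  note H = cubic_homD [OF h]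
  have hgen: "h (?gen i) = st_interval k i" if "i \<le> k" for i
    using hg that assms(2) f by auto
  \<comment> \<open>The uniqueness clause of the universal property also mentions an assignment of the
    generators, for which the constant one is supplied.\<close>
  have ext: "u P = w P"
    if "u \<in> cubic_hom (\<F>r X) (\<I> two_bool)" "w \<in> cubic_hom (\<F>r X) (\<I> two_bool)"
      "\<And>i. i \<le> k \<Longrightarrow> u (?gen i) = w (?gen i)" "P \<in> carrier (\<F>r X)" for u w P
    by (rule free_cubic_universal(2) [OF cubic_interval_two _ that(1,2) _ that(4),
          of "\<lambda>_. (False, True)"]) (use that(3) assms(2) in auto)
  have "inj_on h (carrier (\<F>r X))"
  proof (rule inj_onI, rule ccontr)
    fix P Q
    assume P: "P \<in> carrier (\<F>r X)" and Q: "Q \<in> carrier (\<F>r X)" and eq: "h P = h Q" and ne: "P \<noteq> Q"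
    obtain u where u: "u \<in> cubic_hom (\<F>r X) (\<I> two_bool)" "u P \<noteq> u Q"
      using F.separated_by_coordinates [OF P Q ne] by blast
    \<comment> \<open>If all generators went to the edge, \<open>u\<close> would be constant.\<close>
    have "\<exists>i\<le>k. u (?gen i) \<noteq> (False, True)"
    proof (rule ccontr)
      assume *: "\<not> (\<exists>i\<le>k. u (?gen i) \<noteq> (False, True))"
      have "(\<lambda>_. (False, True)) \<in> cubic_hom (\<F>r X) (\<I> two_bool)" by (simp add: cubic_hom_def)
      from ext [OF u(1) this _ P] ext [OF u(1) this _ Q] * have "u P = u Q" by auto
      with u(2) show False ..
    qed
    define m where "m = (LEAST i. i \<le> k \<and> u (?gen i) \<noteq> (False, True))"
    have "m \<le> k \<and> u (?gen m) \<noteq> (False, True)"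
      unfolding m_def using \<open>\<exists>i\<le>k. _\<close> by (rule LeastI_ex)
    then have mk: "m \<le> k" and um: "u (?gen m) \<noteq> (False, True)" by auto
    have um0: "u (?gen j) = (False, True)" if "j < m" for j
      using not_less_Least [OF that [unfolded m_def]] that mk by auto
    \<comment> \<open>Either \<open>u\<close> or its mirror image has the prescribed first vertex.\<close>
    have "\<exists>w \<in> cubic_hom (\<F>r X) (\<I> two_bool). w P \<noteq> w Q \<and>
      (\<forall>j<m. w (?gen j) = (False, True)) \<and> w (?gen m) = (m \<noteq> 0, m \<noteq> 0)"
    proof (cases "u (?gen m) = (m \<noteq> 0, m \<noteq> 0)")
      case True
      then show ?thesis using u um0 by blast
    next
      case False
      let ?w = "(\<lambda>(a, b). (\<not> b, \<not> a)) \<circ> u"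
      have "?w \<in> cubic_hom (\<F>r X) (\<I> two_bool)" using u(1) flip_hom by (rule cubic_hom_compose)
      moreover have "?w P \<noteq> ?w Q" using u(2) by (auto split: prod.splits)
      moreover have "?w (?gen m) = (m \<noteq> 0, m \<noteq> 0)"
        using interval_two_cases [OF cubic_homD(1) [OF u(1) gen [OF mk]]] um False by auto
      ultimately show ?thesis using um0 by (intro bexI [of _ ?w]) auto
    qed
    then obtain w where w: "w \<in> cubic_hom (\<F>r X) (\<I> two_bool)" "w P \<noteq> w Q"
      "\<And>j. j < m \<Longrightarrow> w (?gen j) = (False, True)" "w (?gen m) = (m \<noteq> 0, m \<noteq> 0)" by blast
    have "st_relations_hold k (\<lambda>i. fst (w (?gen i))) (\<lambda>i. snd (w (?gen i)))"
    proof (rule st_relations_hold_normalized [OF mk])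
      show "snd (w (?gen i))" if "i \<le> k" "fst (w (?gen i))" for i
        using interval_two_cases [OF cubic_homD(1) [OF w(1) gen [OF that(1)]]] that(2) by auto
    qed (use w in auto)
    then obtain v where v: "v \<in> bool_valuations (\<B> k)"
      "\<And>i. i \<le> k \<Longrightarrow> v (s_elem k i) \<longleftrightarrow> fst (w (?gen i))"
      "\<And>i. i \<le> k \<Longrightarrow> v (t_elem k i) \<longleftrightarrow> snd (w (?gen i))"
      by (rule st_bool_valuation) blast
    have "map_prod v v \<in> cubic_hom ?L (\<I> two_bool)"
      unfolding cubic_hom_def Lops
      by (intro CollectI conjI ballI funcsetI subsetD [OF LI]
          cubic_homD [OF st.interval_valuation_hom [OF v(1)]])
    then have vh: "map_prod v v \<circ> h \<in> cubic_hom (\<F>r X) (\<I> two_bool)"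
      using h by (intro cubic_hom_compose)
    have "(map_prod v v \<circ> h) (?gen i) = w (?gen i)" if "i \<le> k" for i
      using that by (simp add: hgen st_interval_def v)
    then have "w P = w Q"
      using ext [OF vh w(1) _ P] ext [OF vh w(1) _ Q] eq by auto
    with w(2) show False ..
  qed
  moreover have "h ` carrier (\<F>r X) = carrier ?L"
  proof (rule equalityI)
    show hL: "h ` carrier (\<F>r X) \<subseteq> carrier ?L" using H(1) by blast
    show "carrier ?L \<subseteq> h ` carrier (\<F>r X)"
    proof (rule st_intervals_generate)
      show "h ` carrier (\<F>r X) \<subseteq> carrier ?I" using hL LI by blast
      show "\<one>\<^bsub>?I\<^esub> \<in> h ` carrier (\<F>r X)"
        using H(2) F.one_closed unfolding Lops by (metis imageI)
      show "x \<squnion>\<^bsub>?I\<^esub> y \<in> h ` carrier (\<F>r X)" "\<Delta>\<^bsub>?I\<^esub> x y \<in> h ` carrier (\<F>r X)"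
        if "x \<in> h ` carrier (\<F>r X)" "y \<in> h ` carrier (\<F>r X)" for x y
        using that F.join_closed F.delta_closed
        by (auto simp: Lops(2,3) [symmetric] H(3,4) [symmetric])
      show "st_interval k i \<in> h ` carrier (\<F>r X)" if "i \<le> k" for i
        using hgen [OF that] gen [OF that] by (metis imageI)
    qed
  qed
  ultimately show ?thesis
    using cubic_iso_inverse [OF L free_cubic_algebra h] by blast
qed

end
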